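(* Suppose that Condition (S) holds. If the control model $\mathfrak{M}(\eta,\Delta)$ is absorbing, then the control model $\mathfrak{M}(\eta^\beta,\Delta)$ (obtained by replacing the initial distribution $\eta$ with $\eta^\beta$) is also absorbing.
   Context: For a measurable space $\mathbf{\Omega}$, $\mathcal{P}(\mathbf{\Omega})$ is the set of probability measures on it. Control model. $(\mathbf{X},\mathfrak{X})$ is a measurable space (state space); $\mathbf{A}$ is a Borel space (action space) with Borel $\sigma$-algebra $\mathfrak{B}(\mathbf{A})$; for each $x\in\mathbf{X}$, $\mathbf{A}(x)\subseteq\mathbf{A}$ is a nonempty measurable set of available actions; $\mathbf{K}=\{(x,a):a\in\mathbf{A}(x)\}$ is assumed to be in $\mathfrak{X}\otimes\mathfrak{B}(\mathbf{A})$ and to contain the graph of a measurable function $f:\mathbf{X}\to\mathbf{A}$ with $f(x)\in\mathbf{A}(x)$ for all $x$; $Q$ is a stochastic kernel on $\mathbf{X}$ given $\mathbf{X}\times\mathbf{A}$; $\eta\in\mathcal{P}(\mathbf{X})$ is an initial distribution; $\Delta\in\mathfrak{X}$ is a given set. This model is denoted $\mathfrak{M}(\eta,\Delta)$. Policies. Let $\mathbf{H}_0=\mathbf{X}$, $\mathbf{H}_n=\mathbf{H}_{n-1}\times\mathbf{A}\times\mathbf{X}$. A policy $\pi=\{\pi_n\}_{n\ge0}\in\mathbf{\Pi}$ is a sequence of stochastic kernels $\pi_n$ on $\mathbf{A}$ given $\mathbf{H}_n$ with $\pi_n(\mathbf{A}(x_n)|h_n)=1$ for all $h_n=(x_0,a_0,\ldots,x_n)\in\mathbf{H}_n$.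 $\mathbf{M}$ is the set of stochastic kernels $\sigma$ on $\mathbf{A}$ given $\mathbf{X}$ with $\sigma(\mathbf{A}(x)|x)=1$ for all $x$; each $\sigma\in\mathbf{M}$ is identified with the stationary randomized policy $\pi_n(\cdot|h_n)=\sigma(\cdot|x_n)$. For an initial distribution $\lambda\in\mathcal{P}(\mathbf{X})$ and $\pi\in\mathbf{\Pi}$, $\mathbb{P}_{\lambda,\pi}$ (expectation $\mathbb{E}_{\lambda,\pi}$) is the unique probability measure on $(\mathbf{X}\times\mathbf{A})^\infty$ under which the coordinate processes satisfy $X_0\sim\lambda$, $\mathbb{P}_{\lambda,\pi}(A_n\in\cdot\mid X_0,A_0,\ldots,X_n)=\pi_n(\cdot\mid X_0,A_0,\ldots,X_n)$ and $\mathbb{P}_{\lambda,\pi}(X_{n+1}\in\cdot\mid X_0,A_0,\ldots,X_n,A_n)=Q(\cdot\mid X_n,A_n)$ almost surely. For $\sigma\in\mathbf{M}$, $Q_\sigma(D|x)=\int_{\mathbf{A}}Q(D|x,a)\sigma(da|x)$, and $Q_\sigma^k$ is its $k$-fold composition, with $Q^0_\sigma(\cdot|x)=\delta_x$. Let $T_\Delta=\min\{n\ge0:X_n\in\Delta\}$ ($=\infty$ if there is no such $n$). The model $\mathfrak{M}(\lambda,\Delta)$ is absorbing if (a) $Q(\Delta|x,a)=1$ for all $(x,a)\in\Delta\times\mathbf{A}$, and (b) $\mathbb{E}_{\lambda,\pi}[T_\Delta]<\infty$ for every $\pi\in\mathbf{\Pi}$. Condition (S): (S1) $\mathbf{A}$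 is compact and the correspondence $x\mapsto\mathbf{A}(x)$ is weakly measurable (i.e. $\{x:\mathbf{A}(x)\cap G\ne\emptyset\}\in\mathfrak{X}$ for every open $G\subseteq\mathbf{A}$) with nonempty compact values; (S2) for every $x\in\mathbf{X}$ and $\Gamma\in\mathfrak{X}$, the mapping $a\mapsto Q(\Gamma|x,a)$ is continuous on $\mathbf{A}(x)$. Reference measure. Under Condition (S) there exists $\xi^*\in\mathbf{M}$ such that $Q(\cdot|x,a)\ll Q_{\xi^*}(\cdot|x)$ for every $(x,a)\in\mathbf{K}$. Fix such a $\xi^*$ and a parameter $0<\beta<1$, and let $\eta^\beta=(1-\beta)\sum_{k=0}^\infty\beta^k\,\eta Q_{\xi^*}^k\in\mathcal{P}(\mathbf{X})$. *)

theory Defs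
  imports "HOL-Probability.Probability"
begin

(* The next two lemmas serve only the proof that the strategic measure exists and is unique. *)

lemma cond_kernel_iff:
  assumes "prob_space P" and Y[measurable]: "Y \<in> P \<rightarrow>\<^sub>M N1" and Z[measurable]: "Z \<in> P \<rightarrow>\<^sub>M N2"
    and k: "\<kappa> \<in> N1 \<rightarrow>\<^sub>M prob_algebra N2" and B[measurable]: "B \<in> sets N2"
  shows "(AE \<omega> in P. real_cond_exp P (vimage_algebra (space P) Y N1) (\<lambda>\<omega>. indicator B (Z \<omega>)) \<omega> = measure (\<kappa> (Y \<omega>)) B)
    \<longleftrightarrow> (\<forall>C\<in>sets N1. emeasure P {\<omega>\<in>space P. Y \<omega> \<in> C \<and> Z \<omega> \<in> B}
        = (\<integral>\<^sup>+\<omega>. emeasure (\<kappa> (Y \<omega>)) B * indicator C (Y \<omega>) \<partial>P))"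
    (is "(AE \<omega> in P. real_cond_exp P ?F ?f \<omega> = ?g \<omega>) \<longleftrightarrow> ?R")
proof -
  interpret prob_space P by fact
  have YF: "Y \<in> ?F \<rightarrow>\<^sub>M N1"
    by (rule measurable_vimage_algebra1) (use measurable_space[OF Y] in auto)
  have setsF: "sets ?F = {Y -` C \<inter> space P | C. C \<in> sets N1}"
    by (rule sets_vimage_algebra2) (use measurable_space[OF Y] in auto)
  have sub: "subalgebra P ?F"
    unfolding subalgebra_def setsF by auto
  interpret F: finite_measure_subalgebra P ?F
    by unfold_locales (rule sub)
  have [measurable]: "(\<lambda>y. measure (\<kappa> y) B) \<in> borel_measurable N1"
    using measurable_compose[OF k measurable_measure_prob_algebra[OF B]] .
  have gF: "?g \<in> borel_measurable ?F"
    by (rule measurable_compose[OF YF]) measurable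
  have [measurable]: "?g \<in> borel_measurable P" by measurable
  have pk: "prob_space (\<kappa> (Y \<omega>))" if "\<omega> \<in> space P" for \<omega>
    using measurable_space[OF k measurable_space[OF Y that]] by (simp add: space_prob_algebra)
  have intf: "integrable P ?f"
    by (rule integrable_const_bound[where B=1]) (auto split: split_indicator)
  have intg: "integrable P ?g"
    by (rule integrable_const_bound[where B=1]) (auto intro!: AE_I2 prob_space.prob_le_1 pk)
  have L: "(\<integral>\<omega>\<in>(Y -` C \<inter> space P). ?f \<omega> \<partial>P) = measure P {\<omega>\<in>space P. Y \<omega> \<in> C \<and> Z \<omega> \<in> B}"
    if [measurable]: "C \<in> sets N1" for C
  proof -
    have "(\<integral>\<omega>\<in>(Y -` C \<inter> space P). ?f \<omega> \<partial>P) = (\<integral>\<omega>. indicator {\<omega>\<in>space P. Y \<omega> \<in> C \<and> Z \<omega> \<in> B} \<omega> \<partial>P)"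
      unfolding set_lebesgue_integral_def
      by (rule Bochner_Integration.integral_cong) (auto split: split_indicator)
    then show ?thesis by simp
  qed
  have R: "ennreal (\<integral>\<omega>\<in>(Y -` C \<inter> space P). ?g \<omega> \<partial>P) = (\<integral>\<^sup>+\<omega>. emeasure (\<kappa> (Y \<omega>)) B * indicator C (Y \<omega>) \<partial>P)"
    if [measurable]: "C \<in> sets N1" for C
  proof -
    have "(\<integral>\<^sup>+\<omega>. emeasure (\<kappa> (Y \<omega>)) B * indicator C (Y \<omega>) \<partial>P)
      = (\<integral>\<^sup>+\<omega>. ennreal (indicator (Y -` C \<inter> space P) \<omega> * ?g \<omega>) \<partial>P)"
      using finite_measure.emeasure_eq_measure[OF prob_space.finite_measure[OF pk]]
      by (intro nn_integral_cong) (auto split: split_indicator)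
    also have "\<dots> = ennreal (\<integral>\<omega>. indicator (Y -` C \<inter> space P) \<omega> * ?g \<omega> \<partial>P)"
      by (rule nn_integral_eq_integral)
         (auto intro!: integrable_real_mult_indicator intg simp: mult.commute)
    finally show ?thesis by (simp add: set_lebesgue_integral_def)
  qed
  have Rnn: "0 \<le> (\<integral>\<omega>\<in>(Y -` C \<inter> space P). ?g \<omega> \<partial>P)" for C
    unfolding set_lebesgue_integral_def by (intro integral_nonneg_AE) auto
  have "?R \<longleftrightarrow> (\<forall>C\<in>sets N1. (\<integral>\<omega>\<in>(Y -` C \<inter> space P). ?f \<omega> \<partial>P) = (\<integral>\<omega>\<in>(Y -` C \<inter> space P). ?g \<omega> \<partial>P))"
    by (simp add: R[symmetric] L emeasure_eq_measure Rnn)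
  also have "\<dots> \<longleftrightarrow> (\<forall>A\<in>sets ?F. (\<integral>\<omega>\<in>A. ?f \<omega> \<partial>P) = (\<integral>\<omega>\<in>A. ?g \<omega> \<partial>P))"
    unfolding setsF by auto
  also have "\<dots> \<longleftrightarrow> (AE \<omega> in P. real_cond_exp P ?F ?f \<omega> = ?g \<omega>)"
  proof
    assume "\<forall>A\<in>sets ?F. (\<integral>\<omega>\<in>A. ?f \<omega> \<partial>P) = (\<integral>\<omega>\<in>A. ?g \<omega> \<partial>P)"
    then show "AE \<omega> in P. real_cond_exp P ?F ?f \<omega> = ?g \<omega>"
      by (intro F.real_cond_exp_charact intf intg gF) auto
  next
    assume ae: "AE \<omega> in P. real_cond_exp P ?F ?f \<omega> = ?g \<omega>"
    show "\<forall>A\<in>sets ?F. (\<integral>\<omega>\<in>A. ?f \<omega> \<partial>P) = (\<integral>\<omega>\<in>A. ?g \<omega> \<partial>P)"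
    proof
      fix A assume A: "A \<in> sets ?F"
      then have [measurable]: "A \<in> sets P" using sub by (auto simp: subalgebra_def)
      have "(\<integral>\<omega>\<in>A. ?f \<omega> \<partial>P) = (\<integral>\<omega>\<in>A. real_cond_exp P ?F ?f \<omega> \<partial>P)"
        by (rule F.real_cond_exp_intA[OF intf A])
      also have "\<dots> = (\<integral>\<omega>\<in>A. ?g \<omega> \<partial>P)"
        by (intro set_lebesgue_integral_cong_AE) (use ae in auto)
      finally show "(\<integral>\<omega>\<in>A. ?f \<omega> \<partial>P) = (\<integral>\<omega>\<in>A. ?g \<omega> \<partial>P)" .
    qed
  qed
  finally show ?thesis by simp
qed

lemma joint_eqI:
  assumes "prob_space P" "prob_space P'" and "sets P = sets P'"
    and Y[measurable]: "Y \<in> P \<rightarrow>\<^sub>M N1" and Z[measurable]: "Z \<in> P \<rightarrow>\<^sub>M N2"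
    and eq: "\<And>C B. C \<in> sets N1 \<Longrightarrow> B \<in> sets N2 \<Longrightarrow>
      emeasure P {\<omega>\<in>space P. Y \<omega> \<in> C \<and> Z \<omega> \<in> B} = emeasure P' {\<omega>\<in>space P'. Y \<omega> \<in> C \<and> Z \<omega> \<in> B}"
  shows "distr P (N1 \<Otimes>\<^sub>M N2) (\<lambda>\<omega>. (Y \<omega>, Z \<omega>)) = distr P' (N1 \<Otimes>\<^sub>M N2) (\<lambda>\<omega>. (Y \<omega>, Z \<omega>))"
proof -
  interpret P: prob_space P by fact
  note [measurable_cong] = \<open>sets P = sets P'\<close>
  have [measurable]: "Y \<in> P' \<rightarrow>\<^sub>M N1" "Z \<in> P' \<rightarrow>\<^sub>M N2"
    using Y Z by (simp_all cong: measurable_cong_sets)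
  show ?thesis
  proof (rule measure_eqI_generator_eq[OF Int_stable_pair_measure_generator[of N1 N2], where A="\<lambda>_. space N1 \<times> space N2" and \<Omega>="space N1 \<times> space N2"])
    show "{a \<times> b |a b. a \<in> sets N1 \<and> b \<in> sets N2} \<subseteq> Pow (space N1 \<times> space N2)"
      by (rule pair_measure_closed)
    fix D assume "D \<in> {a \<times> b |a b. a \<in> sets N1 \<and> b \<in> sets N2}"
    then obtain C B where D: "D = C \<times> B" and [measurable]: "C \<in> sets N1" "B \<in> sets N2" by auto
    have "(\<lambda>\<omega>. (Y \<omega>, Z \<omega>)) -` D \<inter> S = {\<omega>\<in>S. Y \<omega> \<in> C \<and> Z \<omega> \<in> B}" for S by (auto simp: D)
    then show "emeasure (distr P (N1 \<Otimes>\<^sub>M N2) (\<lambda>\<omega>. (Y \<omega>, Z \<omega>))) D = emeasure (distr P' (N1 \<Otimes>\<^sub>M N2) (\<lambda>\<omega>. (Y \<omega>, Z \<omega>))) D"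
      using D by (simp add: emeasure_distr eq)
  next
    show "emeasure (distr P (N1 \<Otimes>\<^sub>M N2) (\<lambda>\<omega>. (Y \<omega>, Z \<omega>))) (space N1 \<times> space N2) \<noteq> \<infinity>"
      by (simp add: emeasure_distr)
  qed (auto simp: sets_pair_measure)
qed

(* A stochastic kernel on N given M is an element of measurable M (prob_algebra N), and
   P(M) is space (prob_algebra M).  A Borel space is a Borel subset A of a Polish space, with
   the subspace topology and the sigma-algebra restrict_space borel A.
   Only the values Q (x, a) with x in space X and a in A are meaningful. *)
locale control_model =
  fixes X :: "'x measure"
    and A :: "'a::polish_space set"
    and Av :: "'x \<Rightarrow> 'a set"
    and Q :: "'x \<times> 'a \<Rightarrow> 'x measure"
  assumes borel_A: "A \<in> sets borel"
    and Av_sets: "x \<in> space X \<Longrightarrow> Av x \<in> sets (restrict_space borel A)"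
    and Av_nonempty: "x \<in> space X \<Longrightarrow> Av x \<noteq> {}"
    and K_sets: "(SIGMA x:space X. Av x) \<in> sets (X \<Otimes>\<^sub>M restrict_space borel A)"
    and selector: "\<exists>f \<in> X \<rightarrow>\<^sub>M restrict_space borel A. \<forall>x\<in>space X. f x \<in> Av x"
    and Q_kernel: "Q \<in> (X \<Otimes>\<^sub>M restrict_space borel A) \<rightarrow>\<^sub>M prob_algebra X"
begin

abbreviation act :: "'a measure" where
  "act \<equiv> restrict_space borel A"

(* A history (x_0, a_0, ..., x_{n-1}, a_{n-1}, x_n) is represented by the pair of the
   finite sequence of its n past state-action pairs and its current state x_n. *)
definition hist_space :: "nat \<Rightarrow> ((nat \<Rightarrow> 'x \<times> 'a) \<times> 'x) measure" where
  "hist_space n = PiM {0..<n} (\<lambda>_. X \<Otimes>\<^sub>M act) \<Otimes>\<^sub>M X"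

definition policies :: "(nat \<Rightarrow> (nat \<Rightarrow> 'x \<times> 'a) \<times> 'x \<Rightarrow> 'a measure) set" where
  "policies = {\<pi>. \<forall>n. \<pi> n \<in> hist_space n \<rightarrow>\<^sub>M prob_algebra act \<and>
     (\<forall>h\<in>space (hist_space n). measure (\<pi> n h) (Av (snd h)) = 1)}"

definition markov_kernels :: "('x \<Rightarrow> 'a measure) set" where
  "markov_kernels = {\<sigma>. \<sigma> \<in> X \<rightarrow>\<^sub>M prob_algebra act \<and>
     (\<forall>x\<in>space X. measure (\<sigma> x) (Av x) = 1)}"

definition traj_space :: "(nat \<Rightarrow> 'x \<times> 'a) measure" where
  "traj_space = PiM UNIV (\<lambda>_. X \<Otimes>\<^sub>M act)"

definition hist :: "nat \<Rightarrow> (nat \<Rightarrow> 'x \<times> 'a) \<Rightarrow> (nat \<Rightarrow> 'x \<times> 'a) \<times> 'x" where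
  "hist n \<omega> = (restrict \<omega> {0..<n}, fst (\<omega> n))"

definition hist_act :: "nat \<Rightarrow> (nat \<Rightarrow> 'x \<times> 'a) \<Rightarrow> ((nat \<Rightarrow> 'x \<times> 'a) \<times> 'x) \<times> 'a" where
  "hist_act n \<omega> = (hist n \<omega>, snd (\<omega> n))"

(* The two vimage algebras are the sigma-algebras generated by X_0, A_0, ..., X_n and by
   X_0, A_0, ..., X_n, A_n; conditional probabilities are conditional expectations of
   indicators. *)
definition is_strategic_measure ::
  "'x measure \<Rightarrow> (nat \<Rightarrow> (nat \<Rightarrow> 'x \<times> 'a) \<times> 'x \<Rightarrow> 'a measure) \<Rightarrow>
   (nat \<Rightarrow> 'x \<times> 'a) measure \<Rightarrow> bool" where
  "is_strategic_measure l \<pi> P \<longleftrightarrow>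
     P \<in> space (prob_algebra traj_space) \<and>
     distr P X (\<lambda>\<omega>. fst (\<omega> 0)) = l \<and>
     (\<forall>n. \<forall>B\<in>sets act. AE \<omega> in P.
        real_cond_exp P (vimage_algebra (space P) (hist n) (hist_space n))
          (\<lambda>\<omega>'. indicator B (snd (\<omega>' n))) \<omega> = measure (\<pi> n (hist n \<omega>)) B) \<and>
     (\<forall>n. \<forall>D\<in>sets X. AE \<omega> in P.
        real_cond_exp P (vimage_algebra (space P) (hist_act n) (hist_space n \<Otimes>\<^sub>M act))
          (\<lambda>\<omega>'. indicator D (fst (\<omega>' (Suc n)))) \<omega> = measure (Q (\<omega> n)) D)"

(* Well-defined by strategic_measure_ex1 below. *)
definition strategic_measure ::
  "'x measure \<Rightarrow> (nat \<Rightarrow> (nat \<Rightarrow> 'x \<times> 'a) \<times> 'x \<Rightarrow> 'a measure) \<Rightarrow> (nat \<Rightarrow> 'x \<times> 'a) measure" where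
  "strategic_measure l \<pi> = (THE P. is_strategic_measure l \<pi> P)"

definition hitting_time :: "'x set \<Rightarrow> (nat \<Rightarrow> 'x \<times> 'a) \<Rightarrow> enat" where
  "hitting_time \<Delta> \<omega> =
     (if \<exists>n. fst (\<omega> n) \<in> \<Delta> then enat (LEAST n. fst (\<omega> n) \<in> \<Delta>) else \<infinity>)"

definition absorbing :: "'x measure \<Rightarrow> 'x set \<Rightarrow> bool" where
  "absorbing l \<Delta> \<longleftrightarrow>
     (\<forall>x\<in>\<Delta>. \<forall>a\<in>A. measure (Q (x, a)) \<Delta> = 1) \<and>
     (\<forall>\<pi>\<in>policies.
        (\<integral>\<^sup>+\<omega>. ennreal_of_enat (hitting_time \<Delta> \<omega>) \<partial>strategic_measure l \<pi>) < \<infinity>)"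

definition condition_S :: bool where
  "condition_S \<longleftrightarrow>
     compact A \<and>
     (\<forall>G. openin (top_of_set A) G \<longrightarrow> {x\<in>space X. Av x \<inter> G \<noteq> {}} \<in> sets X) \<and>
     (\<forall>x\<in>space X. Av x \<noteq> {} \<and> compact (Av x)) \<and>
     (\<forall>x\<in>space X. \<forall>\<Gamma>\<in>sets X. continuous_on (Av x) (\<lambda>a. measure (Q (x, a)) \<Gamma>))"

definition Q_under :: "('x \<Rightarrow> 'a measure) \<Rightarrow> 'x \<Rightarrow> 'x measure" where
  "Q_under \<sigma> x = \<sigma> x \<bind> (\<lambda>a. Q (x, a))"

primrec Q_under_pow :: "('x \<Rightarrow> 'a measure) \<Rightarrow> nat \<Rightarrow> 'x \<Rightarrow> 'x measure" where
  "Q_under_pow \<sigma> 0 x = return X x"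
| "Q_under_pow \<sigma> (Suc k) x = Q_under_pow \<sigma> k x \<bind> Q_under \<sigma>"

definition discounted_initial ::
  "'x measure \<Rightarrow> ('x \<Rightarrow> 'a measure) \<Rightarrow> real \<Rightarrow> 'x measure" where
  "discounted_initial \<eta> \<xi> \<beta> = measure_of (space X) (sets X)
     (\<lambda>D. ennreal (1 - \<beta>) * (\<Sum>k. ennreal (\<beta> ^ k) * emeasure (\<eta> \<bind> Q_under_pow \<xi> k) D))"

lemma measurable_hist[measurable]: "hist n \<in> traj_space \<rightarrow>\<^sub>M hist_space n"
  unfolding hist_def[abs_def] traj_space_def hist_space_def
  by (intro measurable_Pair measurable_restrict_subset) auto

lemma measurable_hist_act[measurable]: "hist_act n \<in> traj_space \<rightarrow>\<^sub>M hist_space n \<Otimes>\<^sub>M act"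
  unfolding hist_act_def[abs_def]
  by (intro measurable_Pair measurable_hist) (simp add: traj_space_def)

lemma measurable_traj[measurable]: "(\<lambda>\<omega>. \<omega> n) \<in> traj_space \<rightarrow>\<^sub>M X \<Otimes>\<^sub>M act"
  by (simp add: traj_space_def)

lemma policiesD: "\<pi> \<in> policies \<Longrightarrow> \<pi> n \<in> hist_space n \<rightarrow>\<^sub>M prob_algebra act"
  by (simp add: policies_def)

lemma is_strategic_measure_iff:
  assumes \<pi>: "\<pi> \<in> policies"
  shows "is_strategic_measure l \<pi> P \<longleftrightarrow>
     P \<in> space (prob_algebra traj_space) \<and>
     distr P X (\<lambda>\<omega>. fst (\<omega> 0)) = l \<and>
     (\<forall>n. \<forall>B\<in>sets act. \<forall>C\<in>sets (hist_space n).
        emeasure P {\<omega>\<in>space P. hist n \<omega> \<in> C \<and> snd (\<omega> n) \<in> B} =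
        (\<integral>\<^sup>+\<omega>. emeasure (\<pi> n (hist n \<omega>)) B * indicator C (hist n \<omega>) \<partial>P)) \<and>
     (\<forall>n. \<forall>D\<in>sets X. \<forall>C\<in>sets (hist_space n \<Otimes>\<^sub>M act).
        emeasure P {\<omega>\<in>space P. hist_act n \<omega> \<in> C \<and> fst (\<omega> (Suc n)) \<in> D} =
        (\<integral>\<^sup>+\<omega>. emeasure (Q (\<omega> n)) D * indicator C (hist_act n \<omega>) \<partial>P))"
proof (cases "P \<in> space (prob_algebra traj_space)")
  case True
  then have P: "prob_space P" and s: "sets P = sets traj_space" by (auto simp: space_prob_algebra)
  note [measurable_cong] = s
  have k: "(\<lambda>((h, x), a). Q (x, a)) \<in> (hist_space n \<Otimes>\<^sub>M act) \<rightarrow>\<^sub>M prob_algebra X" for n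
    unfolding hist_space_def split_beta by (rule measurable_compose[OF _ Q_kernel]) measurable
  have 1: "(AE \<omega> in P. real_cond_exp P (vimage_algebra (space P) (hist n) (hist_space n))
          (\<lambda>\<omega>'. indicator B (snd (\<omega>' n))) \<omega> = measure (\<pi> n (hist n \<omega>)) B) \<longleftrightarrow>
      (\<forall>C\<in>sets (hist_space n).
        emeasure P {\<omega>\<in>space P. hist n \<omega> \<in> C \<and> snd (\<omega> n) \<in> B} =
        (\<integral>\<^sup>+\<omega>. emeasure (\<pi> n (hist n \<omega>)) B * indicator C (hist n \<omega>) \<partial>P))"
    if "B \<in> sets act" for n B
    by (rule cond_kernel_iff[OF P _ _ policiesD[OF \<pi>] that]) measurable
  have 2: "(AE \<omega> in P. real_cond_exp P (vimage_algebra (space P) (hist_act n) (hist_space n \<Otimes>\<^sub>M act))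
          (\<lambda>\<omega>'. indicator D (fst (\<omega>' (Suc n)))) \<omega> = measure (Q (\<omega> n)) D) \<longleftrightarrow>
      (\<forall>C\<in>sets (hist_space n \<Otimes>\<^sub>M act).
        emeasure P {\<omega>\<in>space P. hist_act n \<omega> \<in> C \<and> fst (\<omega> (Suc n)) \<in> D} =
        (\<integral>\<^sup>+\<omega>. emeasure (Q (\<omega> n)) D * indicator C (hist_act n \<omega>) \<partial>P))"
    if "D \<in> sets X" for n D
    using cond_kernel_iff[OF P _ _ k that, of "hist_act n" n "\<lambda>\<omega>. fst (\<omega> (Suc n))"]
    by (simp add: hist_act_def hist_def)
  show ?thesis
    unfolding is_strategic_measure_def using 1 2 by simp
qed (simp add: is_strategic_measure_def)

lemma is_strategic_measure_unique:
  assumes \<pi>: "\<pi> \<in> policies" and "is_strategic_measure l \<pi> P" "is_strategic_measure l \<pi> P'"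
  shows "P = P'"
proof -
  note P = assms(2)[unfolded is_strategic_measure_iff[OF \<pi>]]
  note P' = assms(3)[unfolded is_strategic_measure_iff[OF \<pi>]]
  have s: "sets P = sets traj_space" "sets P' = sets traj_space" and p: "prob_space P" "prob_space P'"
    using P P' by (auto simp: space_prob_algebra)
  note [measurable_cong] = s
  interpret P: prob_space P by fact
  have \<pi>m[measurable]: "(\<lambda>h. emeasure (\<pi> n h) B) \<in> borel_measurable (hist_space n)" if "B \<in> sets act" for n B
    using measurable_emeasure_kernel[OF measurable_prob_algebraD[OF policiesD[OF \<pi>]] that] .
  have Qm[measurable]: "(\<lambda>y. emeasure (Q y) D) \<in> borel_measurable (X \<Otimes>\<^sub>M act)" if "D \<in> sets X" for D
    using measurable_emeasure_kernel[OF measurable_prob_algebraD[OF Q_kernel] that] .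
  have A: "distr P (hist_space n \<Otimes>\<^sub>M act) (hist_act n) = distr P' (hist_space n \<Otimes>\<^sub>M act) (hist_act n)"
    if H: "distr P (hist_space n) (hist n) = distr P' (hist_space n) (hist n)" for n
    unfolding hist_act_def[abs_def]
  proof (rule joint_eqI[OF p])
    fix C B assume [measurable]: "C \<in> sets (hist_space n)" "B \<in> sets act"
    have "(\<integral>\<^sup>+\<omega>. emeasure (\<pi> n (hist n \<omega>)) B * indicator C (hist n \<omega>) \<partial>R)
      = (\<integral>\<^sup>+h. emeasure (\<pi> n h) B * indicator C h \<partial>distr R (hist_space n) (hist n))"
      if [measurable_cong]: "sets R = sets traj_space" for R
      by (subst nn_integral_distr) measurable
    from this[OF s(1)] this[OF s(2)] H
    show "emeasure P {\<omega>\<in>space P. hist n \<omega> \<in> C \<and> snd (\<omega> n) \<in> B} =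
      emeasure P' {\<omega>\<in>space P'. hist n \<omega> \<in> C \<and> snd (\<omega> n) \<in> B}"
      using P P' by simp
  next
    show "sets P = sets P'" using s by simp
    show "hist n \<in> P \<rightarrow>\<^sub>M hist_space n" "(\<lambda>\<omega>. snd (\<omega> n)) \<in> P \<rightarrow>\<^sub>M act" by measurable
  qed
  have B: "distr P ((hist_space n \<Otimes>\<^sub>M act) \<Otimes>\<^sub>M X) (\<lambda>\<omega>. (hist_act n \<omega>, fst (\<omega> (Suc n)))) =
           distr P' ((hist_space n \<Otimes>\<^sub>M act) \<Otimes>\<^sub>M X) (\<lambda>\<omega>. (hist_act n \<omega>, fst (\<omega> (Suc n))))"
    if H: "distr P (hist_space n \<Otimes>\<^sub>M act) (hist_act n) = distr P' (hist_space n \<Otimes>\<^sub>M act) (hist_act n)" for n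
  proof (rule joint_eqI[OF p])
    fix C D assume [measurable]: "C \<in> sets (hist_space n \<Otimes>\<^sub>M act)" "D \<in> sets X"
    have [measurable]: "snd \<in> hist_space n \<rightarrow>\<^sub>M X" by (simp add: hist_space_def)
    have "(\<integral>\<^sup>+\<omega>. emeasure (Q (\<omega> n)) D * indicator C (hist_act n \<omega>) \<partial>R)
      = (\<integral>\<^sup>+y. emeasure (Q (snd (fst y), snd y)) D * indicator C y \<partial>distr R (hist_space n \<Otimes>\<^sub>M act) (hist_act n))"
      if [measurable_cong]: "sets R = sets traj_space" for R
      by (subst nn_integral_distr) (measurable, simp add: hist_act_def hist_def)
    from this[OF s(1)] this[OF s(2)] H
    show "emeasure P {\<omega>\<in>space P. hist_act n \<omega> \<in> C \<and> fst (\<omega> (Suc n)) \<in> D} =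
      emeasure P' {\<omega>\<in>space P'. hist_act n \<omega> \<in> C \<and> fst (\<omega> (Suc n)) \<in> D}"
      using P P' by simp
  next
    show "sets P = sets P'" using s by simp
    show "hist_act n \<in> P \<rightarrow>\<^sub>M hist_space n \<Otimes>\<^sub>M act" "(\<lambda>\<omega>. fst (\<omega> (Suc n))) \<in> P \<rightarrow>\<^sub>M X" by measurable
  qed
  have H: "distr P (hist_space n) (hist n) = distr P' (hist_space n) (hist n)" for n
  proof (induction n)
    case 0
    have m: "(\<lambda>x. (\<lambda>_. undefined, x)) \<in> X \<rightarrow>\<^sub>M hist_space 0"
      unfolding hist_space_def by (intro measurable_Pair) (auto simp: space_PiM)
    have "distr R (hist_space 0) (hist 0) = distr (distr R X (\<lambda>\<omega>. fst (\<omega> 0))) (hist_space 0) (\<lambda>x. (\<lambda>_. undefined, x))"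
      if [measurable_cong]: "sets R = sets traj_space" for R
      by (subst distr_distr[OF m]) (auto intro!: distr_cong simp: hist_def restrict_def)
    from this[OF s(1)] this[OF s(2)] show ?case using P P' by simp
  next
    case (Suc n)
    define g :: "(((nat \<Rightarrow> 'x \<times> 'a) \<times> 'x) \<times> 'a) \<times> 'x \<Rightarrow> (nat \<Rightarrow> 'x \<times> 'a) \<times> 'x"
      where "g = (\<lambda>(((h, x), a), y). (h(n := (x, a)), y))"
    have g: "g \<in> ((hist_space n \<Otimes>\<^sub>M act) \<Otimes>\<^sub>M X) \<rightarrow>\<^sub>M hist_space (Suc n)"
      unfolding g_def hist_space_def split_beta
      by (intro measurable_Pair measurable_fun_upd[where J="{0..<n}"]) auto
    have gh: "g (hist_act n \<omega>, fst (\<omega> (Suc n))) = hist (Suc n) \<omega>" for \<omega>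
      by (auto simp: g_def hist_act_def hist_def fun_eq_iff)
    have "distr R (hist_space (Suc n)) (hist (Suc n)) =
      distr (distr R ((hist_space n \<Otimes>\<^sub>M act) \<Otimes>\<^sub>M X) (\<lambda>\<omega>. (hist_act n \<omega>, fst (\<omega> (Suc n))))) (hist_space (Suc n)) g"
      if [measurable_cong]: "sets R = sets traj_space" for R
      by (subst distr_distr[OF g]) (measurable, auto intro!: distr_cong simp: gh)
    from this[OF s(1)] this[OF s(2)] B[OF A[OF Suc]] show ?case by simp
  qed
  have R: "distr P (PiM {0..<n} (\<lambda>_. X \<Otimes>\<^sub>M act)) (\<lambda>\<omega>. restrict \<omega> {0..<n}) =
     distr P' (PiM {0..<n} (\<lambda>_. X \<Otimes>\<^sub>M act)) (\<lambda>\<omega>. restrict \<omega> {0..<n})" for n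
  proof -
    have m: "fst \<in> hist_space n \<rightarrow>\<^sub>M PiM {0..<n} (\<lambda>_. X \<Otimes>\<^sub>M act)" by (simp add: hist_space_def)
    have "distr R (PiM {0..<n} (\<lambda>_. X \<Otimes>\<^sub>M act)) (\<lambda>\<omega>. restrict \<omega> {0..<n}) =
      distr (distr R (hist_space n) (hist n)) (PiM {0..<n} (\<lambda>_. X \<Otimes>\<^sub>M act)) fst"
      if [measurable_cong]: "sets R = sets traj_space" for R
      by (subst distr_distr[OF m]) (auto intro!: distr_cong simp: hist_def)
    from this[OF s(1)] this[OF s(2)] H[of n] show ?thesis by simp
  qed
  show "P = P'"
  proof (rule measure_eqI_PiM_infinite[where I=UNIV and M="\<lambda>_. X \<Otimes>\<^sub>M act"])
    fix F :: "nat \<Rightarrow> ('x \<times> 'a) set" and J :: "nat set"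
    assume J: "finite J" "\<And>i. i \<in> J \<Longrightarrow> F i \<in> sets (X \<Otimes>\<^sub>M act)"
    then obtain n where n: "J \<subseteq> {0..<n}"
      by (metis atLeast0LessThan finite_nat_iff_bounded)
    let ?E = "prod_emb {0..<n} (\<lambda>_. X \<Otimes>\<^sub>M act) J (Pi\<^sub>E J F)"
    have E: "?E \<in> sets (PiM {0..<n} (\<lambda>_. X \<Otimes>\<^sub>M act))"
      by (rule measurable_prod_emb) (use n J in auto)
    have "emeasure R (prod_emb UNIV (\<lambda>_. X \<Otimes>\<^sub>M act) J (Pi\<^sub>E J F))
      = emeasure (distr R (PiM {0..<n} (\<lambda>_. X \<Otimes>\<^sub>M act)) (\<lambda>\<omega>. restrict \<omega> {0..<n})) ?E"
      if sR: "sets R = sets traj_space" for R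
    proof -
      have "space R = space traj_space" using sR by (rule sets_eq_imp_space_eq)
      then have "(\<lambda>\<omega>. restrict \<omega> {0..<n}) -` ?E \<inter> space R = prod_emb UNIV (\<lambda>_. X \<Otimes>\<^sub>M act) J (Pi\<^sub>E J F)"
        using n by (auto simp: prod_emb_def traj_space_def space_PiM PiE_iff subset_eq restrict_def extensional_def)
      moreover have "(\<lambda>\<omega>. restrict \<omega> {0..<n}) \<in> R \<rightarrow>\<^sub>M PiM {0..<n} (\<lambda>_. X \<Otimes>\<^sub>M act)"
        unfolding measurable_cong_sets[OF sR refl] traj_space_def
        by (rule measurable_restrict_subset) simp
      ultimately show ?thesis
        by (simp add: emeasure_distr E)
    qed
    from this[OF s(1)] this[OF s(2)] R[of n]
    show "emeasure P (prod_emb UNIV (\<lambda>_. X \<Otimes>\<^sub>M act) J (Pi\<^sub>E J F)) =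
       emeasure P' (prod_emb UNIV (\<lambda>_. X \<Otimes>\<^sub>M act) J (Pi\<^sub>E J F))" by simp
  qed (use s P.finite_measure_axioms in \<open>auto simp: traj_space_def\<close>)
qed


lemma is_strategic_measure_exists:
  assumes l: "l \<in> space (prob_algebra X)" and \<pi>: "\<pi> \<in> policies"
  shows "\<exists>P. is_strategic_measure l \<pi> P"
proof -
  let ?E = "X \<Otimes>\<^sub>M act"
  let ?H = "\<lambda>n::nat. PiM {0..<n} (\<lambda>_. X \<Otimes>\<^sub>M act)"
  define S where "S n h = (if n = 0 then l else Q (h (n - 1)))" for n and h :: "nat \<Rightarrow> 'x \<times> 'a"
  define K where "K n h = S n h \<bind> (\<lambda>x. distr (\<pi> n (h, x)) ?E (Pair x))" for n h
  have S[measurable]: "S n \<in> ?H n \<rightarrow>\<^sub>M prob_algebra X" for n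
  proof (cases "n = 0")
    case False
    then show ?thesis
      unfolding S_def by (simp, intro measurable_compose[OF _ Q_kernel] measurable_component_singleton) simp
  qed (use l in \<open>simp add: S_def[abs_def]\<close>)
  have \<pi>n[measurable]: "\<pi> n \<in> (?H n \<Otimes>\<^sub>M X) \<rightarrow>\<^sub>M prob_algebra act" for n
    using policiesD[OF \<pi>] by (simp add: hist_space_def)
  have step: "(\<lambda>(h, x). distr (\<pi> n (h, x)) ?E (Pair x)) \<in> ?H n \<Otimes>\<^sub>M X \<rightarrow>\<^sub>M prob_algebra ?E" for n
    by measurable
  have K[measurable]: "K n \<in> ?H n \<rightarrow>\<^sub>M prob_algebra ?E" for n
    unfolding K_def[abs_def] by (intro measurable_bind_prob_space2[OF S] step)
  have Kint: "(\<integral>\<^sup>+y. f y \<partial>K n h) = (\<integral>\<^sup>+x. \<integral>\<^sup>+a. f (x, a) \<partial>\<pi> n (h, x) \<partial>S n h)"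
    if h: "h \<in> space (?H n)" and f[measurable]: "f \<in> borel_measurable ?E" for n h f
  proof -
    have sS: "sets (S n h) = sets X"
      using measurable_space[OF S h] by (simp add: space_prob_algebra)
    have m: "(\<lambda>x. distr (\<pi> n (h, x)) ?E (Pair x)) \<in> S n h \<rightarrow>\<^sub>M subprob_algebra ?E"
      unfolding measurable_cong_sets[OF sS refl]
      using measurable_compose[OF measurable_Pair1'[OF h, of X] step] by (auto intro: measurable_prob_algebraD)
    have "(\<integral>\<^sup>+y. f y \<partial>K n h) = (\<integral>\<^sup>+x. \<integral>\<^sup>+y. f y \<partial>distr (\<pi> n (h, x)) ?E (Pair x) \<partial>S n h)"
      unfolding K_def by (rule nn_integral_bind[OF f m])
    also have "\<dots> = (\<integral>\<^sup>+x. \<integral>\<^sup>+a. f (x, a) \<partial>\<pi> n (h, x) \<partial>S n h)"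
    proof (rule nn_integral_cong)
      fix x assume "x \<in> space (S n h)"
      then have x: "x \<in> space X" using sets_eq_imp_space_eq[OF sS] by simp
      then have "sets (\<pi> n (h, x)) = sets act"
        using measurable_space[OF \<pi>n, of "(h, x)"] h by (auto simp: space_prob_algebra space_pair_measure)
      then have "Pair x \<in> \<pi> n (h, x) \<rightarrow>\<^sub>M ?E"
        using measurable_Pair1'[OF x, of act] by (simp cong: measurable_cong_sets)
      then show "(\<integral>\<^sup>+y. f y \<partial>distr (\<pi> n (h, x)) ?E (Pair x)) = (\<integral>\<^sup>+a. f (x, a) \<partial>\<pi> n (h, x))"
        by (subst nn_integral_distr) auto
    qed
    finally show ?thesis .
  qed
  have KS: "K i \<in> ?H i \<rightarrow>\<^sub>M subprob_algebra ?E" for i by (rule measurable_prob_algebraD[OF K])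
  have KP: "prob_space (K i x)" if "x \<in> space (?H i)" for i x
    using measurable_space[OF K that] by (simp add: space_prob_algebra)
  interpret IT: Ionescu_Tulcea K "\<lambda>_. ?E"
    by (intro Ionescu_Tulcea.intro KS KP)
  define L where "L = IT.PF.lim"
  have sL[measurable_cong]: "sets L = sets traj_space"
    by (simp add: L_def traj_space_def)
  have spL: "space L = space traj_space" using sL by (rule sets_eq_imp_space_eq)
  have "prob_space L"
  proof -
    have "prob_space (IT.CI {})" by (rule IT.PF.prob_space_P) auto
    then have "prob_space (distr L (PiM {} (\<lambda>_. ?E)) (\<lambda>x. restrict x {}))"
      unfolding L_def by (subst IT.distr_lim) auto
    then show ?thesis
      by (rule prob_space_distrD[rotated])
         (simp add: measurable_cong_sets[OF sL refl] traj_space_def measurable_restrict_subset)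
  qed
  have rm[measurable]: "(\<lambda>\<omega>. restrict \<omega> {0..<n}) \<in> traj_space \<rightarrow>\<^sub>M ?H n" for n
    unfolding traj_space_def by (rule measurable_restrict_subset) simp
  have up: "IT.up_to {0..<n} = n" for n
    by (metis IT.up_to IT.up_to_iff_Ico finite_atLeastLessThan atLeast0LessThan lessThan_subset_iff order_antisym order_refl)
  have dL: "distr L (?H n) (\<lambda>\<omega>. restrict \<omega> {0..<n}) = IT.C 0 n (\<lambda>_. undefined)" for n
    unfolding L_def using IT.distr_C[of n n "\<lambda>_. undefined" 0]
    by (subst IT.distr_lim) (auto simp: IT.CI_def up space_PiM)
  have star: "(\<integral>\<^sup>+\<omega>. f (restrict \<omega> {0..<Suc n}) \<partial>L) =
    (\<integral>\<^sup>+\<omega>. \<integral>\<^sup>+x. \<integral>\<^sup>+a. f ((restrict \<omega> {0..<n})(n := (x, a))) \<partial>\<pi> n (restrict \<omega> {0..<n}, x)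
       \<partial>S n (restrict \<omega> {0..<n}) \<partial>L)"
    if f[measurable]: "f \<in> borel_measurable (?H (Suc n))" for n f
  proof -
    have u: "(\<lambda>_. undefined) \<in> space (?H 0)" by (simp add: space_PiM PiE_iff extensional_def)
    have sC: "space (IT.C 0 n (\<lambda>_. undefined)) = space (?H n)" "sets (IT.C 0 n (\<lambda>_. undefined)) = sets (?H n)"
      using IT.space_C[OF u] IT.sets_C[OF u] by simp_all
    have "(\<integral>\<^sup>+\<omega>. f (restrict \<omega> {0..<Suc n}) \<partial>L) = (\<integral>\<^sup>+h. f h \<partial>IT.C 0 (Suc n) (\<lambda>_. undefined))"
      unfolding dL[symmetric] by (subst nn_integral_distr) measurable
    also have "\<dots> = (\<integral>\<^sup>+h. \<integral>\<^sup>+k. f k \<partial>IT.eP n h \<partial>IT.C 0 n (\<lambda>_. undefined))"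
      using IT.measurable_eP[of n]
      by (simp, subst nn_integral_bind[OF f]) (auto simp: measurable_cong_sets[OF sC(2) refl])
    also have "\<dots> = (\<integral>\<^sup>+h. \<integral>\<^sup>+y. f (h(n := y)) \<partial>K n h \<partial>IT.C 0 n (\<lambda>_. undefined))"
      by (intro nn_integral_cong) (simp add: sC IT.nn_integral_eP)
    also have "\<dots> = (\<integral>\<^sup>+\<omega>. \<integral>\<^sup>+y. f ((restrict \<omega> {0..<n})(n := y)) \<partial>K n (restrict \<omega> {0..<n}) \<partial>L)"
    proof -
      have "(\<lambda>(h, y). f (h(n := y))) \<in> borel_measurable (?H n \<Otimes>\<^sub>M ?E)"
        unfolding split_beta
        by (rule measurable_compose[OF measurable_fun_upd[where J="{0..<n}"] f]) auto
      then have "(\<lambda>h. \<integral>\<^sup>+y. f (h(n := y)) \<partial>K n h) \<in> borel_measurable (?H n)"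
        by (rule nn_integral_measurable_subprob_algebra2) (rule measurable_prob_algebraD[OF K])
      then show ?thesis unfolding dL[symmetric] by (subst nn_integral_distr) (measurable, simp_all)
    qed
    also have "\<dots> = (\<integral>\<^sup>+\<omega>. \<integral>\<^sup>+x. \<integral>\<^sup>+a. f ((restrict \<omega> {0..<n})(n := (x, a))) \<partial>\<pi> n (restrict \<omega> {0..<n}, x)
       \<partial>S n (restrict \<omega> {0..<n}) \<partial>L)"
    proof (intro nn_integral_cong Kint)
      fix \<omega> assume w: "\<omega> \<in> space L"
      show h: "restrict \<omega> {0..<n} \<in> space (?H n)"
        using measurable_space[OF rm] w spL by auto
      show "(\<lambda>y. f ((restrict \<omega> {0..<n})(n := y))) \<in> borel_measurable ?E"
        by (rule measurable_compose[OF measurable_fun_upd[where J="{0..<n}"] f])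
           (auto intro: measurable_const[OF h])
    qed
    finally show ?thesis .
  qed
  have space_h: "restrict \<omega> {0..<n} \<in> space (?H n)" if "\<omega> \<in> space L" for \<omega> n
    using measurable_space[OF rm] that spL by auto
  have Sp: "prob_space (S n h)" "sets (S n h) = sets X" "space (S n h) = space X" if "h \<in> space (?H n)" for n h
    using measurable_space[OF S that] by (auto simp: space_prob_algebra dest: sets_eq_imp_space_eq)
  have \<pi>p: "prob_space (\<pi> n (h, x))" "sets (\<pi> n (h, x)) = sets act" if "h \<in> space (?H n)" "x \<in> space X" for n h x
    using measurable_space[OF \<pi>n, of "(h, x)" n] that by (auto simp: space_prob_algebra space_pair_measure)
  have comp: "(\<lambda>h. h n) \<in> ?H (Suc n) \<rightarrow>\<^sub>M ?E" for n
    by (rule measurable_component_singleton) simp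
  have "is_strategic_measure l \<pi> L"
    unfolding is_strategic_measure_iff[OF \<pi>]
  proof (intro conjI allI ballI)
    show "L \<in> space (prob_algebra traj_space)"
      using \<open>prob_space L\<close> sL by (simp add: space_prob_algebra)
    interpret prob_space L by fact
    show "distr L X (\<lambda>\<omega>. fst (\<omega> 0)) = l"
    proof (rule measure_eqI)
      show "sets (distr L X (\<lambda>\<omega>. fst (\<omega> 0))) = sets l" using l by (simp add: space_prob_algebra)
      fix D assume "D \<in> sets (distr L X (\<lambda>\<omega>. fst (\<omega> 0)))"
      then have D[measurable]: "D \<in> sets X" by simp
      have f: "(\<lambda>h. indicator D (fst (h 0)) :: ennreal) \<in> borel_measurable (?H (Suc 0))"
        using comp[of 0] by measurable
      have m: "(\<lambda>\<omega>. fst (\<omega> 0)) \<in> L \<rightarrow>\<^sub>M X" by measurable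
      have "emeasure (distr L X (\<lambda>\<omega>. fst (\<omega> 0))) D = (\<integral>\<^sup>+y. indicator D y \<partial>distr L X (\<lambda>\<omega>. fst (\<omega> 0)))"
        by simp
      also have "\<dots> = (\<integral>\<^sup>+\<omega>. indicator D (fst (\<omega> 0)) \<partial>L)"
        by (rule nn_integral_distr[OF m]) simp
      also have "\<dots> = (\<integral>\<^sup>+\<omega>. \<integral>\<^sup>+x. \<integral>\<^sup>+a. indicator D x \<partial>\<pi> 0 (restrict \<omega> {0..<0}, x) \<partial>S 0 (restrict \<omega> {0..<0}) \<partial>L)"
        using star[OF f] by simp
      also have "\<dots> = (\<integral>\<^sup>+\<omega>. \<integral>\<^sup>+x. indicator D x \<partial>l \<partial>L)"
      proof (intro nn_integral_cong)
        fix \<omega> assume w: "\<omega> \<in> space L"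
        have "(\<integral>\<^sup>+x. \<integral>\<^sup>+a. indicator D x \<partial>\<pi> 0 (restrict \<omega> {0..<0}, x) \<partial>S 0 (restrict \<omega> {0..<0}))
          = (\<integral>\<^sup>+x. indicator D x \<partial>S 0 (restrict \<omega> {0..<0}))"
          by (intro nn_integral_cong)
             (simp add: Sp[OF space_h[OF w]] prob_space.emeasure_space_1[OF \<pi>p(1)[OF space_h[OF w]]] del: atLeastLessThan_empty)
        then show "(\<integral>\<^sup>+x. \<integral>\<^sup>+a. indicator D x \<partial>\<pi> 0 (restrict \<omega> {0..<0}, x) \<partial>S 0 (restrict \<omega> {0..<0})) = (\<integral>\<^sup>+x. indicator D x \<partial>l)"
          by (simp add: S_def)
      qed
      also have "\<dots> = emeasure l D"
        using l D by (simp add: emeasure_space_1 space_prob_algebra)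
      finally show "emeasure (distr L X (\<lambda>\<omega>. fst (\<omega> 0))) D = emeasure l D" .
    qed
    fix n
    {
      fix B C assume B[measurable]: "B \<in> sets act" and C: "C \<in> sets (hist_space n)"
      have ev: "{\<omega>\<in>space L. hist n \<omega> \<in> C \<and> snd (\<omega> n) \<in> B} \<in> sets L"
      proof -
        note C[measurable]
        show ?thesis by measurable
      qed
      have C'[measurable]: "C \<in> sets (?H n \<Otimes>\<^sub>M X)" using C by (simp add: hist_space_def)
      have r[measurable]: "(\<lambda>h. restrict h {0..<n}) \<in> ?H (Suc n) \<rightarrow>\<^sub>M ?H n"
        by (rule measurable_restrict_subset) auto
      note [measurable] = comp[of n]
      have pm[measurable]: "(\<lambda>h. emeasure (\<pi> n h) B) \<in> borel_measurable (?H n \<Otimes>\<^sub>M X)"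
        using measurable_emeasure_kernel[OF measurable_prob_algebraD[OF \<pi>n] B] .
      let ?f = "\<lambda>h. indicator C (restrict h {0..<n}, fst (h n)) * indicator B (snd (h n)) :: ennreal"
      let ?g = "\<lambda>h. emeasure (\<pi> n (restrict h {0..<n}, fst (h n))) B * indicator C (restrict h {0..<n}, fst (h n))"
      have "emeasure L {\<omega>\<in>space L. hist n \<omega> \<in> C \<and> snd (\<omega> n) \<in> B} = (\<integral>\<^sup>+\<omega>. indicator {\<omega>\<in>space L. hist n \<omega> \<in> C \<and> snd (\<omega> n) \<in> B} \<omega> \<partial>L)"
        by (rule nn_integral_indicator[symmetric, OF ev])
      also have "\<dots> = (\<integral>\<^sup>+\<omega>. ?f (restrict \<omega> {0..<Suc n}) \<partial>L)"
        by (intro nn_integral_cong) (auto simp: hist_def Int_absorb2 Int_absorb1 split: split_indicator)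
      also have "\<dots> = (\<integral>\<^sup>+\<omega>. \<integral>\<^sup>+x. \<integral>\<^sup>+a. ?f ((restrict \<omega> {0..<n})(n := (x, a))) \<partial>\<pi> n (restrict \<omega> {0..<n}, x) \<partial>S n (restrict \<omega> {0..<n}) \<partial>L)"
        by (rule star) measurable
      also have "\<dots> = (\<integral>\<^sup>+\<omega>. \<integral>\<^sup>+x. \<integral>\<^sup>+a. ?g ((restrict \<omega> {0..<n})(n := (x, a))) \<partial>\<pi> n (restrict \<omega> {0..<n}, x) \<partial>S n (restrict \<omega> {0..<n}) \<partial>L)"
      proof (rule nn_integral_cong, rule nn_integral_cong)
        fix \<omega> x assume w: "\<omega> \<in> space L" and "x \<in> space (S n (restrict \<omega> {0..<n}))"
        then have x: "x \<in> space X" by (simp add: Sp[OF space_h[OF w]])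
        interpret p: prob_space "\<pi> n (restrict \<omega> {0..<n}, x)" by (rule \<pi>p[OF space_h[OF w] x])
        have "restrict ((restrict \<omega> {0..<n})(n := (x, a))) {0..<n} = restrict \<omega> {0..<n}" for a by auto
        then show "(\<integral>\<^sup>+a. ?f ((restrict \<omega> {0..<n})(n := (x, a))) \<partial>\<pi> n (restrict \<omega> {0..<n}, x)) = (\<integral>\<^sup>+a. ?g ((restrict \<omega> {0..<n})(n := (x, a))) \<partial>\<pi> n (restrict \<omega> {0..<n}, x))"
          using B by (simp add: nn_integral_cmult_indicator p.emeasure_space_1 \<pi>p(2)[OF space_h[OF w] x])
            (rule mult.commute)
      qed
      also have "\<dots> = (\<integral>\<^sup>+\<omega>. ?g (restrict \<omega> {0..<Suc n}) \<partial>L)"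
        by (rule star[symmetric]) measurable
      also have "\<dots> = (\<integral>\<^sup>+\<omega>. emeasure (\<pi> n (hist n \<omega>)) B * indicator C (hist n \<omega>) \<partial>L)"
        by (intro nn_integral_cong) (auto simp: hist_def Int_absorb2 Int_absorb1 split: split_indicator)
      finally show "emeasure L {\<omega>\<in>space L. hist n \<omega> \<in> C \<and> snd (\<omega> n) \<in> B} =
          (\<integral>\<^sup>+\<omega>. emeasure (\<pi> n (hist n \<omega>)) B * indicator C (hist n \<omega>) \<partial>L)" .
    }
    {
      fix D C assume D[measurable]: "D \<in> sets X" and C: "C \<in> sets (hist_space n \<Otimes>\<^sub>M act)"
      have ev: "{\<omega>\<in>space L. hist_act n \<omega> \<in> C \<and> fst (\<omega> (Suc n)) \<in> D} \<in> sets L"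
      proof -
        note C[measurable]
        show ?thesis by measurable
      qed
      have C'[measurable]: "C \<in> sets ((?H n \<Otimes>\<^sub>M X) \<Otimes>\<^sub>M act)" using C by (simp add: hist_space_def)
      have r[measurable]: "(\<lambda>h. restrict h {0..<n}) \<in> ?H (Suc (Suc n)) \<rightarrow>\<^sub>M ?H n"
        by (rule measurable_restrict_subset) auto
      have [measurable]: "(\<lambda>h. h n) \<in> ?H (Suc (Suc n)) \<rightarrow>\<^sub>M ?E" "(\<lambda>h. h (Suc n)) \<in> ?H (Suc (Suc n)) \<rightarrow>\<^sub>M ?E"
        by (rule measurable_component_singleton; simp)+
      let ?f = "\<lambda>h. indicator C (hist_act n h) * indicator D (fst (h (Suc n))) :: ennreal"
      have fm: "?f \<in> borel_measurable (?H (Suc (Suc n)))"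
        unfolding hist_act_def hist_def by measurable
      have ra: "hist_act n (restrict \<omega> {0..<Suc (Suc n)}) = hist_act n \<omega>" "hist_act n ((restrict \<omega> {0..<Suc n})(Suc n := y)) = hist_act n \<omega>"
        "hist_act n (restrict (fun_upd \<omega> (Suc n) y) (insert (Suc n) {0..<Suc n})) = hist_act n \<omega>" for \<omega> y
        by (auto simp: hist_act_def hist_def fun_eq_iff)
      have "emeasure L {\<omega>\<in>space L. hist_act n \<omega> \<in> C \<and> fst (\<omega> (Suc n)) \<in> D} = (\<integral>\<^sup>+\<omega>. indicator {\<omega>\<in>space L. hist_act n \<omega> \<in> C \<and> fst (\<omega> (Suc n)) \<in> D} \<omega> \<partial>L)"
        by (rule nn_integral_indicator[symmetric, OF ev])
      also have "\<dots> = (\<integral>\<^sup>+\<omega>. ?f (restrict \<omega> {0..<Suc (Suc n)}) \<partial>L)"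
        by (intro nn_integral_cong) (auto simp: ra split: split_indicator)
      also have "\<dots> = (\<integral>\<^sup>+\<omega>. \<integral>\<^sup>+x. \<integral>\<^sup>+a. ?f ((restrict \<omega> {0..<Suc n})(Suc n := (x, a))) \<partial>\<pi> (Suc n) (restrict \<omega> {0..<Suc n}, x) \<partial>S (Suc n) (restrict \<omega> {0..<Suc n}) \<partial>L)"
        by (rule star[OF fm])
      also have "\<dots> = (\<integral>\<^sup>+\<omega>. emeasure (Q (\<omega> n)) D * indicator C (hist_act n \<omega>) \<partial>L)"
      proof (intro nn_integral_cong)
        fix \<omega> assume w: "\<omega> \<in> space L"
        have "(\<integral>\<^sup>+x. \<integral>\<^sup>+a. ?f ((restrict \<omega> {0..<Suc n})(Suc n := (x, a))) \<partial>\<pi> (Suc n) (restrict \<omega> {0..<Suc n}, x) \<partial>S (Suc n) (restrict \<omega> {0..<Suc n}))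
          = (\<integral>\<^sup>+x. indicator C (hist_act n \<omega>) * indicator D x \<partial>S (Suc n) (restrict \<omega> {0..<Suc n}))"
          by (intro nn_integral_cong)
             (simp add: ra Sp[OF space_h[OF w]] prob_space.emeasure_space_1[OF \<pi>p(1)[OF space_h[OF w]]])
        also have "\<dots> = indicator C (hist_act n \<omega>) * emeasure (S (Suc n) (restrict \<omega> {0..<Suc n})) D"
          using D Sp(2)[OF space_h[OF w, of "Suc n"]] by (simp add: nn_integral_cmult)
        finally show "(\<integral>\<^sup>+x. \<integral>\<^sup>+a. ?f ((restrict \<omega> {0..<Suc n})(Suc n := (x, a))) \<partial>\<pi> (Suc n) (restrict \<omega> {0..<Suc n}, x) \<partial>S (Suc n) (restrict \<omega> {0..<Suc n}))
          = emeasure (Q (\<omega> n)) D * indicator C (hist_act n \<omega>)"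
          by (simp add: S_def mult.commute)
      qed
      finally show "emeasure L {\<omega>\<in>space L. hist_act n \<omega> \<in> C \<and> fst (\<omega> (Suc n)) \<in> D} =
        (\<integral>\<^sup>+\<omega>. emeasure (Q (\<omega> n)) D * indicator C (hist_act n \<omega>) \<partial>L)" .
    }
  qed
  then show ?thesis ..
qed

lemma strategic_measure_ex1:
  "l \<in> space (prob_algebra X) \<Longrightarrow> \<pi> \<in> policies \<Longrightarrow> \<exists>!P. is_strategic_measure l \<pi> P"
  using is_strategic_measure_exists is_strategic_measure_unique by blast

lemma Q_under_kernel:
  assumes "\<sigma> \<in> markov_kernels"
  shows "Q_under \<sigma> \<in> X \<rightarrow>\<^sub>M prob_algebra X"
  unfolding Q_under_def[abs_def] using assms Q_kernel
  by (intro measurable_bind_prob_space2[where N=act]) (auto simp: markov_kernels_def)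

lemma Q_under_pow_kernel:
  assumes "\<sigma> \<in> markov_kernels"
  shows "Q_under_pow \<sigma> k \<in> X \<rightarrow>\<^sub>M prob_algebra X"
proof (induction k)
  case 0
  have "Q_under_pow \<sigma> 0 = return X" by (simp add: fun_eq_iff)
  then show ?case by simp
next
  case (Suc k)
  have "Q_under_pow \<sigma> (Suc k) = (\<lambda>x. Q_under_pow \<sigma> k x \<bind> Q_under \<sigma>)" by (simp add: fun_eq_iff)
  then show ?case using measurable_bind_prob_space[OF Suc Q_under_kernel[OF assms]] by simp
qed

lemma emeasure_discounted_initial:
  assumes e: "\<eta> \<in> space (prob_algebra X)" and "\<xi> \<in> markov_kernels" and D: "D \<in> sets X"
  shows "emeasure (discounted_initial \<eta> \<xi> \<beta>) D =
    ennreal (1 - \<beta>) * (\<Sum>k. ennreal (\<beta> ^ k) * emeasure (\<eta> \<bind> Q_under_pow \<xi> k) D)"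
  unfolding discounted_initial_def
proof (rule emeasure_measure_of_sigma)
  have s: "sets (\<eta> \<bind> Q_under_pow \<xi> k) = sets X" for k
    by (rule sets_bind'[OF e Q_under_pow_kernel[OF assms(2)]])
  show "sigma_algebra (space X) (sets X)" ..
  show "positive (sets X) (\<lambda>D. ennreal (1 - \<beta>) * (\<Sum>k. ennreal (\<beta> ^ k) * emeasure (\<eta> \<bind> Q_under_pow \<xi> k) D))"
    by (simp add: positive_def)
  show "countably_additive (sets X) (\<lambda>D. ennreal (1 - \<beta>) * (\<Sum>k. ennreal (\<beta> ^ k) * emeasure (\<eta> \<bind> Q_under_pow \<xi> k) D))"
  proof (rule countably_additiveI)
    fix F :: "nat \<Rightarrow> 'x set" assume F: "range F \<subseteq> sets X" "disjoint_family F"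
    have "(\<Sum>i. \<Sum>k. ennreal (\<beta> ^ k) * emeasure (\<eta> \<bind> Q_under_pow \<xi> k) (F i))
      = (\<Sum>k. \<Sum>i. ennreal (\<beta> ^ k) * emeasure (\<eta> \<bind> Q_under_pow \<xi> k) (F i))"
      using nn_integral_suminf[of "\<lambda>k i. ennreal (\<beta> ^ k) * emeasure (\<eta> \<bind> Q_under_pow \<xi> k) (F i)" "count_space UNIV"]
      by (simp only: nn_integral_count_space_nat borel_measurable_count_space)
    also have "\<dots> = (\<Sum>k. ennreal (\<beta> ^ k) * emeasure (\<eta> \<bind> Q_under_pow \<xi> k) (\<Union>i. F i))"
      using F s by (simp add: suminf_emeasure)
    finally show "(\<Sum>i. ennreal (1 - \<beta>) * (\<Sum>k. ennreal (\<beta> ^ k) * emeasure (\<eta> \<bind> Q_under_pow \<xi> k) (F i)))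
      = ennreal (1 - \<beta>) * (\<Sum>k. ennreal (\<beta> ^ k) * emeasure (\<eta> \<bind> Q_under_pow \<xi> k) (\<Union>i. F i))"
      by simp
  qed
qed fact

lemma discounted_initial_prob:
  assumes e: "\<eta> \<in> space (prob_algebra X)" and x: "\<xi> \<in> markov_kernels" and b: "0 < \<beta>" "\<beta> < 1"
  shows "discounted_initial \<eta> \<xi> \<beta> \<in> space (prob_algebra X)"
proof -
  have s: "sets (discounted_initial \<eta> \<xi> \<beta>) = sets X" by (simp add: discounted_initial_def)
  have 1: "emeasure (\<eta> \<bind> Q_under_pow \<xi> k) (space X) = 1" for k
    using prob_space.emeasure_space_1[OF prob_space_bind'[OF e Q_under_pow_kernel[OF x]]]
      sets_eq_imp_space_eq[OF sets_bind'[OF e Q_under_pow_kernel[OF x]]] by simp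
  have "(\<Sum>k. ennreal (\<beta> ^ k)) = ennreal (1 / (1 - \<beta>))"
    using b geometric_sums[of \<beta>] by (intro suminf_ennreal_eq) auto
  then have "emeasure (discounted_initial \<eta> \<xi> \<beta>) (space X) = 1"
    using b by (simp add: emeasure_discounted_initial[OF e x] 1 ennreal_mult[symmetric] del: ennreal_divide_numeral)
  then show ?thesis
    using s sets_eq_imp_space_eq[OF s] by (auto simp: space_prob_algebra intro!: prob_spaceI)
qed

end

end

theory Submission
  imports Defs
begin

text \<open>
  The discounted initial distribution is a geometric mixture: it is the law of the state reached
  from \<open>\<eta>\<close> after a geometrically distributed number \<open>K\<close> of steps under \<open>\<xi>\<close>. Running a policy \<open>\<pi>\<close>
  from this law is therefore the same as running, from \<open>\<eta>\<close>, the plan ``draw \<open>K\<close>, use \<open>\<xi>\<close> for \<open>K\<close>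
  steps, then start \<open>\<pi>\<close> afresh'' and reading the trajectory from time \<open>K\<close> on
  (\<open>strategic_measure_shift\<close>, \<open>strategic_measure_bind_pmf\<close>). Because the target set is never left
  once entered, discarding the first \<open>K\<close> steps can only decrease the hitting time
  (\<open>hitting_time_shift_le\<close>). So the expected hitting time of \<open>\<pi>\<close> from the discounted law is at most
  that of the plan from \<open>\<eta>\<close>.

  The plan uses a hidden random variable \<open>K\<close> and is not itself a policy. However, the mixture of
  the trajectory laws of countably many policies is the trajectory law of a single policy
  (\<open>mixture_policy_exists\<close>): given a history, draw an index from its posterior distribution and act
  as the policy with that index would. This one policy has a finite expected hitting time by
  assumption. Using one policy that realises the whole mixture is what makes the sum over \<open>K\<close>
  finite; finiteness for each value of \<open>K\<close> separately would say nothing about the sum.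
\<close>

section \<open>Countable mixtures and posterior distributions\<close>

lemma kernel_from_pmf:
  fixes p :: "'i pmf"
  assumes "\<And>k. M k \<in> space (prob_algebra N)"
  shows "M \<in> measure_pmf p \<rightarrow>\<^sub>M prob_algebra N"
  using assms by auto

lemma nn_integral_bind_pmf:
  fixes p :: "'i pmf"
  assumes "\<And>k. M k \<in> space (prob_algebra N)" and "f \<in> borel_measurable N"
  shows "(\<integral>\<^sup>+y. f y \<partial>(measure_pmf p \<bind> M)) = (\<integral>\<^sup>+k. \<integral>\<^sup>+y. f y \<partial>M k \<partial>p)"
  by (rule nn_integral_bind[OF assms(2) measurable_prob_algebraD[OF kernel_from_pmf[OF assms(1)]]])

lemma bind_pmf_in_prob_algebra:
  fixes p :: "'i pmf"
  assumes "\<And>k. M k \<in> space (prob_algebra N)"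
  shows "measure_pmf p \<bind> M \<in> space (prob_algebra N)"
proof -
  have p: "measure_pmf p \<in> space (prob_algebra (measure_pmf p))"
    by (simp add: space_prob_algebra measure_pmf.prob_space_axioms)
  note k = kernel_from_pmf[of M N p, OF assms]
  show ?thesis
    using prob_space_bind'[OF p k] sets_bind'[OF p k] by (simp add: space_prob_algebra)
qed

lemma emeasure_bind_pmf:
  fixes p :: "'i pmf"
  assumes "\<And>k. M k \<in> space (prob_algebra N)" and "B \<in> sets N"
  shows "emeasure (measure_pmf p \<bind> M) B = (\<integral>\<^sup>+k. emeasure (M k) B \<partial>p)"
  by (rule emeasure_bind[OF _ measurable_prob_algebraD[OF kernel_from_pmf[OF assms(1)]] assms(2)]) simp

lemma nn_integral_pmf_swap:
  fixes p :: "'i::countable pmf" and f :: "'i \<Rightarrow> 'b \<Rightarrow> ennreal"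
  assumes [measurable]: "\<And>k. f k \<in> borel_measurable M"
  shows "(\<integral>\<^sup>+k. \<integral>\<^sup>+x. f k x \<partial>M \<partial>p) = (\<integral>\<^sup>+x. \<integral>\<^sup>+k. f k x \<partial>p \<partial>M)"
  using nn_integral_count_space_nn_integral[of UNIV "\<lambda>k x. ennreal (pmf p k) * f k x" M]
  by (simp add: nn_integral_measure_pmf nn_integral_cmult)

lemma measurable_nn_integral_pmf:
  fixes p :: "'i::countable pmf" and f :: "'i \<Rightarrow> 'b \<Rightarrow> ennreal"
  assumes "\<And>k. f k \<in> borel_measurable M"
  shows "(\<lambda>x. \<integral>\<^sup>+k. f k x \<partial>p) \<in> borel_measurable M"
proof -
  have "(\<lambda>(k, x). f k x) \<in> borel_measurable (count_space UNIV \<Otimes>\<^sub>M M)"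
    using assms by (intro measurable_pair_measure_countable1) auto
  from measurable_compose[OF measurable_pair_swap' this]
  have "(\<lambda>(x, k). f k x) \<in> borel_measurable (M \<Otimes>\<^sub>M measure_pmf p)"
    by (simp add: split_beta' sets_pair_measure_cong[OF refl sets_measure_pmf_count_space] cong: measurable_cong_sets)
  then show ?thesis
    by (rule sigma_finite_measure.borel_measurable_nn_integral[OF measure_pmf.sigma_finite_measure_axioms])
qed

text \<open>
  Bayes' rule for a countable parameter \<open>k\<close> with prior \<open>p\<close> and observation laws \<open>M k\<close>. Each \<open>M k\<close> of
  positive prior weight is dominated by the marginal law of the observation, so its Radon--Nikodym
  derivative is the likelihood ratio that reweights the prior into the posterior.
\<close>

lemma posterior_kernel_exists:
  fixes p :: "'i::countable pmf" and M :: "'i \<Rightarrow> 'h measure"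
  assumes M: "\<And>k. M k \<in> space (prob_algebra H)"
  obtains post where "post \<in> H \<rightarrow>\<^sub>M prob_algebra (count_space UNIV)"
    and "\<And>g. (\<And>k. g k \<in> borel_measurable H) \<Longrightarrow>
      (\<integral>\<^sup>+k. \<integral>\<^sup>+h. g k h \<partial>M k \<partial>p) = (\<integral>\<^sup>+h. \<integral>\<^sup>+k. g k h \<partial>post h \<partial>(measure_pmf p \<bind> M))"
proof -
  define R where "R = measure_pmf p \<bind> M"
  define f where "f k = RN_deriv R (M k)" for k
  define Z where "Z h = (\<integral>\<^sup>+k. f k h \<partial>p)" for h
  \<comment> \<open>Off the almost sure event \<open>Z h = 1\<close> the reweighted prior need not be a probability measure; the prior is the default there.\<close>
  define post where "post h = (if Z h = 1 then density (measure_pmf p) (\<lambda>k. f k h) else measure_pmf p)" for h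
  have "R \<in> space (prob_algebra H)" unfolding R_def by (rule bind_pmf_in_prob_algebra[OF M])
  then have sR[measurable_cong]: "sets R = sets H" and "prob_space R" by (auto simp: space_prob_algebra)
  interpret R: prob_space R by fact
  have sM: "sets (M k) = sets H" and pM: "prob_space (M k)" for k using M[of k] by (auto simp: space_prob_algebra)
  have fm[measurable]: "f k \<in> borel_measurable H" for k
    using borel_measurable_RN_deriv[of R "M k"] by (simp add: f_def cong: measurable_cong_sets sR)
  have Zm[measurable]: "Z \<in> borel_measurable H"
    unfolding Z_def by (rule measurable_nn_integral_pmf) measurable
  have ac: "absolutely_continuous R (M k)" if "k \<in> set_pmf p" for k
    unfolding absolutely_continuous_def
  proof
    fix S assume S: "S \<in> null_sets R"
    then have [measurable]: "S \<in> sets H" using sR by auto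
    have "(\<integral>\<^sup>+k. emeasure (M k) S \<partial>p) = 0"
      using S emeasure_bind_pmf[OF M, of S p] by (auto simp: R_def)
    then have "AE k in p. emeasure (M k) S = 0"
      by (subst (asm) nn_integral_0_iff_AE) auto
    then have "emeasure (M k) S = 0" using that by (auto simp: AE_measure_pmf_iff)
    then show "S \<in> null_sets (M k)" using sM by auto
  qed
  have int: "(\<integral>\<^sup>+h. u h \<partial>M k) = (\<integral>\<^sup>+h. f k h * u h \<partial>R)" if "k \<in> set_pmf p" "u \<in> borel_measurable H" for k u
    unfolding f_def using that by (intro R.RN_deriv_nn_integral ac) (auto simp: sM sR cong: measurable_cong_sets)
  have swap: "(\<integral>\<^sup>+k. \<integral>\<^sup>+h. g k h \<partial>M k \<partial>p) = (\<integral>\<^sup>+h. \<integral>\<^sup>+k. f k h * g k h \<partial>p \<partial>R)"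
    if [measurable]: "\<And>k. g k \<in> borel_measurable H" for g
  proof -
    have "(\<integral>\<^sup>+k. \<integral>\<^sup>+h. g k h \<partial>M k \<partial>p) = (\<integral>\<^sup>+k. \<integral>\<^sup>+h. f k h * g k h \<partial>R \<partial>p)"
      by (intro nn_integral_cong_AE) (auto simp: AE_measure_pmf_iff intro!: int)
    also have "\<dots> = (\<integral>\<^sup>+h. \<integral>\<^sup>+k. f k h * g k h \<partial>p \<partial>R)"
      by (rule nn_integral_pmf_swap) measurable
    finally show ?thesis .
  qed
  \<comment> \<open>Integrating \<open>Z\<close> over any set returns the marginal probability of that set.\<close>
  have Z1: "AE h in R. Z h = 1"
  proof (rule R.density_unique)
    show "density R Z = density R (\<lambda>_. 1)"
    proof (rule measure_eqI)
      fix S assume "S \<in> sets (density R Z)"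
      then have [measurable]: "S \<in> sets H" by (simp add: sR)
      have "emeasure (density R Z) S = (\<integral>\<^sup>+h. Z h * indicator S h \<partial>R)"
        by (intro emeasure_density) measurable
      also have "\<dots> = (\<integral>\<^sup>+h. \<integral>\<^sup>+k. f k h * indicator S h \<partial>p \<partial>R)"
        unfolding Z_def by (simp add: nn_integral_multc)
      also have "\<dots> = (\<integral>\<^sup>+k. \<integral>\<^sup>+h. indicator S h \<partial>M k \<partial>p)"
        by (rule swap[symmetric]) measurable
      also have "\<dots> = (\<integral>\<^sup>+k. emeasure (M k) S \<partial>p)"
        using sM by simp
      also have "\<dots> = emeasure (density R (\<lambda>_. 1)) S"
        unfolding R_def by (simp add: density_1 emeasure_bind_pmf[OF M])
      finally show "emeasure (density R Z) S = emeasure (density R (\<lambda>_. 1)) S" .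
    qed simp
  qed measurable
  have "post \<in> H \<rightarrow>\<^sub>M prob_algebra (count_space UNIV)"
  proof (rule measurable_prob_algebraI)
    show "prob_space (post h)" for h
      by (auto simp: post_def Z_def emeasure_density measure_pmf.prob_space_axioms intro!: prob_spaceI)
    show "post \<in> H \<rightarrow>\<^sub>M subprob_algebra (count_space UNIV)"
    proof (rule measurable_subprob_algebra)
      show "subprob_space (post h)" for h
        by (rule prob_space_imp_subprob_space) fact
      show "sets (post h) = sets (count_space UNIV)" for h by (simp add: post_def)
      fix S :: "'i set"
      have "(\<lambda>h. emeasure (post h) S) =
        (\<lambda>h. if Z h = 1 then \<integral>\<^sup>+k. f k h * indicator S k \<partial>p else emeasure p S)"
        by (auto simp: post_def emeasure_density)
      moreover have [measurable]: "(\<lambda>h. \<integral>\<^sup>+k. f k h * indicator S k \<partial>p) \<in> borel_measurable H"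
        by (rule measurable_nn_integral_pmf) measurable
      ultimately show "(\<lambda>h. emeasure (post h) S) \<in> borel_measurable H" by simp
    qed
  qed
  moreover have "(\<integral>\<^sup>+k. \<integral>\<^sup>+h. g k h \<partial>M k \<partial>p) = (\<integral>\<^sup>+h. \<integral>\<^sup>+k. g k h \<partial>post h \<partial>(measure_pmf p \<bind> M))"
    if "\<And>k. g k \<in> borel_measurable H" for g
    unfolding swap[OF that] R_def[symmetric]
    by (intro nn_integral_cong_AE eventually_mono[OF Z1]) (simp add: post_def nn_integral_density)
  ultimately show thesis by (rule that)
qed


context control_model
begin

section \<open>Mixtures of strategic measures\<close>

lemma is_strategic_measure_strategic_measure:
  assumes "l \<in> space (prob_algebra X)" "\<pi> \<in> policies"
  shows "is_strategic_measure l \<pi> (strategic_measure l \<pi>)"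
  unfolding strategic_measure_def by (rule theI'[OF strategic_measure_ex1[OF assms]])

lemma strategic_measure_in_space:
  assumes "l \<in> space (prob_algebra X)" "\<pi> \<in> policies"
  shows "strategic_measure l \<pi> \<in> space (prob_algebra traj_space)"
  using is_strategic_measure_strategic_measure[OF assms] by (simp add: is_strategic_measure_def)

lemma strategic_measure_eqI:
  assumes "\<pi> \<in> policies" "is_strategic_measure l \<pi> P"
  shows "strategic_measure l \<pi> = P"
  unfolding strategic_measure_def
  using assms by (intro the_equality) (auto intro: is_strategic_measure_unique)

lemma measurable_policy:
  assumes "\<pi> \<in> policies" "B \<in> sets act"
  shows "(\<lambda>h. emeasure (\<pi> n h) B) \<in> borel_measurable (hist_space n)"
  using measurable_emeasure_kernel[OF measurable_prob_algebraD[OF policiesD[OF assms(1)]] assms(2)] .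

lemma measurable_Q:
  assumes "D \<in> sets X"
  shows "(\<lambda>y. emeasure (Q y) D) \<in> borel_measurable (X \<Otimes>\<^sub>M act)"
  using measurable_emeasure_kernel[OF measurable_prob_algebraD[OF Q_kernel] assms] .

text \<open>
  The initial law and the action law enter the characterisation linearly in the measure, and the
  transition law does so with an integrand \<open>Q\<close> that is common to all components. Hence a mixture
  automatically has the right initial law and transitions, and only the action law of the
  candidate policy \<open>\<pi>\<close> is left as a hypothesis.
\<close>

lemma is_strategic_measure_mixture:
  fixes p :: "'i::countable pmf"
  assumes \<sigma>: "\<And>k. \<sigma> k \<in> policies" and \<pi>: "\<pi> \<in> policies"
    and l: "\<And>k. l k \<in> space (prob_algebra X)"
    and P: "\<And>k. is_strategic_measure (l k) (\<sigma> k) (P k)"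
    and actions: "\<And>n B C. B \<in> sets act \<Longrightarrow> C \<in> sets (hist_space n) \<Longrightarrow>
      (\<integral>\<^sup>+k. \<integral>\<^sup>+\<omega>. emeasure (\<sigma> k n (hist n \<omega>)) B * indicator C (hist n \<omega>) \<partial>P k \<partial>p)
      = (\<integral>\<^sup>+\<omega>. emeasure (\<pi> n (hist n \<omega>)) B * indicator C (hist n \<omega>) \<partial>(measure_pmf p \<bind> P))"
  shows "is_strategic_measure (measure_pmf p \<bind> l) \<pi> (measure_pmf p \<bind> P)"
proof -
  note S = P[unfolded is_strategic_measure_iff[OF \<sigma>]]
  have Pp: "P k \<in> space (prob_algebra traj_space)" for k using S by blast
  have R: "measure_pmf p \<bind> P \<in> space (prob_algebra traj_space)" by (rule bind_pmf_in_prob_algebra[OF Pp])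
  have sR[measurable_cong]: "sets (measure_pmf p \<bind> P) = sets traj_space" using R by (simp add: space_prob_algebra)
  have spR: "space (measure_pmf p \<bind> P) = space traj_space" by (rule sets_eq_imp_space_eq[OF sR])
  have sP[measurable_cong]: "sets (P k) = sets traj_space" for k using Pp[of k] by (simp add: space_prob_algebra)
  have spP: "space (P k) = space traj_space" for k by (rule sets_eq_imp_space_eq[OF sP])
  have initial_law: "distr (measure_pmf p \<bind> P) X (\<lambda>\<omega>. fst (\<omega> 0)) = measure_pmf p \<bind> l"
  proof (rule measure_eqI)
    show "sets (distr (measure_pmf p \<bind> P) X (\<lambda>\<omega>. fst (\<omega> 0))) = sets (measure_pmf p \<bind> l)"
      using bind_pmf_in_prob_algebra[of l X p, OF l] by (simp add: space_prob_algebra)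
    fix D assume "D \<in> sets (distr (measure_pmf p \<bind> P) X (\<lambda>\<omega>. fst (\<omega> 0)))"
    then have D[measurable]: "D \<in> sets X" by simp
    have e: "emeasure (l k) D = emeasure (P k) {\<omega>\<in>space traj_space. fst (\<omega> 0) \<in> D}" for k
    proof -
      have "emeasure (l k) D = emeasure (distr (P k) X (\<lambda>\<omega>. fst (\<omega> 0))) D" using S by simp
      also have "\<dots> = emeasure (P k) {\<omega>\<in>space traj_space. fst (\<omega> 0) \<in> D}"
        by (subst emeasure_distr) (auto simp: spP intro!: arg_cong[where f="emeasure (P k)"])
      finally show ?thesis .
    qed
    have "emeasure (distr (measure_pmf p \<bind> P) X (\<lambda>\<omega>. fst (\<omega> 0))) D
        = emeasure (measure_pmf p \<bind> P) {\<omega>\<in>space traj_space. fst (\<omega> 0) \<in> D}"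
      by (subst emeasure_distr) (auto simp: spR intro!: arg_cong[where f="emeasure (measure_pmf p \<bind> P)"])
    also have "\<dots> = emeasure (measure_pmf p \<bind> l) D"
      by (simp add: emeasure_bind_pmf[OF Pp] emeasure_bind_pmf[OF l] e)
    finally show "emeasure (distr (measure_pmf p \<bind> P) X (\<lambda>\<omega>. fst (\<omega> 0))) D = emeasure (measure_pmf p \<bind> l) D" .
  qed
  show ?thesis
    unfolding is_strategic_measure_iff[OF \<pi>]
  proof (intro conjI allI ballI)
    fix n B C assume B[measurable]: "B \<in> sets act" and C[measurable]: "C \<in> sets (hist_space n)"
    have "emeasure (measure_pmf p \<bind> P) {\<omega>\<in>space traj_space. hist n \<omega> \<in> C \<and> snd (\<omega> n) \<in> B}
      = (\<integral>\<^sup>+k. emeasure (P k) {\<omega>\<in>space (P k). hist n \<omega> \<in> C \<and> snd (\<omega> n) \<in> B} \<partial>p)"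
      unfolding spP by (rule emeasure_bind_pmf[OF Pp]) measurable
    also have "\<dots> = (\<integral>\<^sup>+k. \<integral>\<^sup>+\<omega>. emeasure (\<sigma> k n (hist n \<omega>)) B * indicator C (hist n \<omega>) \<partial>P k \<partial>p)"
      using S B C by simp
    also note actions[OF B C]
    finally show "emeasure (measure_pmf p \<bind> P) {\<omega>\<in>space (measure_pmf p \<bind> P). hist n \<omega> \<in> C \<and> snd (\<omega> n) \<in> B}
      = (\<integral>\<^sup>+\<omega>. emeasure (\<pi> n (hist n \<omega>)) B * indicator C (hist n \<omega>) \<partial>(measure_pmf p \<bind> P))"
      unfolding spR .
  next
    fix n D C assume D[measurable]: "D \<in> sets X" and C[measurable]: "C \<in> sets (hist_space n \<Otimes>\<^sub>M act)"
    note [measurable] = measurable_compose[OF measurable_traj measurable_Q[OF D]]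
    have "emeasure (measure_pmf p \<bind> P) {\<omega>\<in>space traj_space. hist_act n \<omega> \<in> C \<and> fst (\<omega> (Suc n)) \<in> D}
      = (\<integral>\<^sup>+k. emeasure (P k) {\<omega>\<in>space (P k). hist_act n \<omega> \<in> C \<and> fst (\<omega> (Suc n)) \<in> D} \<partial>p)"
      unfolding spP by (rule emeasure_bind_pmf[OF Pp]) measurable
    also have "\<dots> = (\<integral>\<^sup>+k. \<integral>\<^sup>+\<omega>. emeasure (Q (\<omega> n)) D * indicator C (hist_act n \<omega>) \<partial>P k \<partial>p)"
      using S D C by simp
    also have "\<dots> = (\<integral>\<^sup>+\<omega>. emeasure (Q (\<omega> n)) D * indicator C (hist_act n \<omega>) \<partial>(measure_pmf p \<bind> P))"
      by (rule nn_integral_bind_pmf[OF Pp, symmetric]) measurable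
    finally show "emeasure (measure_pmf p \<bind> P) {\<omega>\<in>space (measure_pmf p \<bind> P). hist_act n \<omega> \<in> C \<and> fst (\<omega> (Suc n)) \<in> D}
      = (\<integral>\<^sup>+\<omega>. emeasure (Q (\<omega> n)) D * indicator C (hist_act n \<omega>) \<partial>(measure_pmf p \<bind> P))"
      unfolding spR .
  qed (rule R, rule initial_law)
qed

lemma strategic_measure_bind_pmf:
  fixes p :: "'i::countable pmf"
  assumes \<pi>: "\<pi> \<in> policies" and l: "\<And>k. l k \<in> space (prob_algebra X)"
  shows "strategic_measure (measure_pmf p \<bind> l) \<pi> = measure_pmf p \<bind> (\<lambda>k. strategic_measure (l k) \<pi>)"
proof (rule strategic_measure_eqI[OF \<pi>], rule is_strategic_measure_mixture[OF \<pi> \<pi> l])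
  show "is_strategic_measure (l k) \<pi> (strategic_measure (l k) \<pi>)" for k
    by (rule is_strategic_measure_strategic_measure[OF l \<pi>])
  fix n B C assume B[measurable]: "B \<in> sets act" and C[measurable]: "C \<in> sets (hist_space n)"
  note [measurable] = measurable_compose[OF measurable_hist measurable_policy[OF \<pi> B]]
  have m: "(\<lambda>\<omega>. emeasure (\<pi> n (hist n \<omega>)) B * indicator C (hist n \<omega>)) \<in> borel_measurable traj_space"
    by measurable
  show "(\<integral>\<^sup>+k. \<integral>\<^sup>+\<omega>. emeasure (\<pi> n (hist n \<omega>)) B * indicator C (hist n \<omega>) \<partial>strategic_measure (l k) \<pi> \<partial>p)
    = (\<integral>\<^sup>+\<omega>. emeasure (\<pi> n (hist n \<omega>)) B * indicator C (hist n \<omega>) \<partial>(measure_pmf p \<bind> (\<lambda>k. strategic_measure (l k) \<pi>)))"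
    by (rule nn_integral_bind_pmf[OF strategic_measure_in_space[OF l \<pi>] m, symmetric])
qed

text \<open>
  The policy \<open>\<pi>\<close> draws a new index from the posterior given the current history at every step,
  independently of the earlier draws. This changes the joint law of indices and actions but not the
  conditional law of the next action given the history, which is all that the trajectory law
  depends on.
\<close>

lemma mixture_policy_exists:
  fixes p :: "'i::countable pmf"
  assumes l: "l \<in> space (prob_algebra X)" and \<sigma>: "\<And>k. \<sigma> k \<in> policies"
  obtains \<pi> where "\<pi> \<in> policies"
    and "strategic_measure l \<pi> = measure_pmf p \<bind> (\<lambda>k. strategic_measure l (\<sigma> k))"
proof -
  define P where "P k = strategic_measure l (\<sigma> k)" for k
  have P: "is_strategic_measure l (\<sigma> k) (P k)" for k
    unfolding P_def by (rule is_strategic_measure_strategic_measure[OF l \<sigma>])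
  have Pp: "P k \<in> space (prob_algebra traj_space)" for k
    unfolding P_def by (rule strategic_measure_in_space[OF l \<sigma>])
  define R where "R = measure_pmf p \<bind> P"
  have sP[measurable_cong]: "sets (P k) = sets traj_space" for k using Pp[of k] by (simp add: space_prob_algebra)
  have sR[measurable_cong]: "sets R = sets traj_space"
    using bind_pmf_in_prob_algebra[of P traj_space p, OF Pp] by (simp add: space_prob_algebra R_def)
  define M where "M n k = distr (P k) (hist_space n) (hist n)" for n k
  have Mp: "M n k \<in> space (prob_algebra (hist_space n))" for n k
    unfolding M_def using measurable_space[OF measurable_distr_prob_space[OF measurable_hist] Pp] .
  have MR: "(\<integral>\<^sup>+h. u h \<partial>(measure_pmf p \<bind> M n)) = (\<integral>\<^sup>+\<omega>. u (hist n \<omega>) \<partial>R)"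
    if [measurable]: "u \<in> borel_measurable (hist_space n)" for n u
    by (simp add: nn_integral_bind_pmf[OF Mp that] R_def)
       (subst nn_integral_bind_pmf[OF Pp], measurable, simp add: M_def nn_integral_distr)
  define Bayes where "Bayes n post \<longleftrightarrow> post \<in> hist_space n \<rightarrow>\<^sub>M prob_algebra (count_space UNIV) \<and>
      (\<forall>g. (\<forall>k. g k \<in> borel_measurable (hist_space n)) \<longrightarrow>
      (\<integral>\<^sup>+k. \<integral>\<^sup>+h. g k h \<partial>M n k \<partial>p) = (\<integral>\<^sup>+h. \<integral>\<^sup>+k. g k h \<partial>post h \<partial>(measure_pmf p \<bind> M n)))"
    for n post
  have "\<exists>post. Bayes n post" for n
    unfolding Bayes_def by (rule posterior_kernel_exists[of "M n" "hist_space n" p, OF Mp]) blast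
  then obtain post where "\<And>n. Bayes n (post n)" by metis
  then have post: "\<And>n. post n \<in> hist_space n \<rightarrow>\<^sub>M prob_algebra (count_space UNIV)"
    and bayes: "\<And>n g. (\<And>k. g k \<in> borel_measurable (hist_space n)) \<Longrightarrow>
      (\<integral>\<^sup>+k. \<integral>\<^sup>+h. g k h \<partial>M n k \<partial>p) = (\<integral>\<^sup>+h. \<integral>\<^sup>+k. g k h \<partial>post n h \<partial>(measure_pmf p \<bind> M n))"
    by (simp_all add: Bayes_def)
  define \<pi> where "\<pi> n h = post n h \<bind> (\<lambda>k. \<sigma> k n h)" for n h
  have postp: "post n h \<in> space (prob_algebra (count_space UNIV))" if "h \<in> space (hist_space n)" for n h
    by (rule measurable_space[OF post that])
  have \<sigma>p: "\<sigma> k n h \<in> space (prob_algebra act)" if "h \<in> space (hist_space n)" for n k h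
    by (rule measurable_space[OF policiesD[OF \<sigma>] that])
  have e\<pi>: "emeasure (\<pi> n h) B = (\<integral>\<^sup>+k. emeasure (\<sigma> k n h) B \<partial>post n h)"
    if "h \<in> space (hist_space n)" "B \<in> sets act" for n h B
    unfolding \<pi>_def by (rule emeasure_bind_prob_algebra[OF postp[OF that(1)] _ that(2)]) (use \<sigma>p[OF that(1)] in auto)
  have \<pi>m: "\<pi> n \<in> hist_space n \<rightarrow>\<^sub>M prob_algebra act" for n
  proof -
    have "(\<lambda>(k, h). \<sigma> k n h) \<in> count_space UNIV \<Otimes>\<^sub>M hist_space n \<rightarrow>\<^sub>M prob_algebra act"
      using policiesD[OF \<sigma>] by (intro measurable_pair_measure_countable1) auto
    from measurable_compose[OF measurable_pair_swap' this]
    have "(\<lambda>(h, k). \<sigma> k n h) \<in> hist_space n \<Otimes>\<^sub>M count_space UNIV \<rightarrow>\<^sub>M prob_algebra act"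
      by (simp add: split_beta')
    then show ?thesis unfolding \<pi>_def[abs_def] by (rule measurable_bind_prob_space2[OF post])
  qed
  have \<pi>: "\<pi> \<in> policies"
    unfolding policies_def mem_Collect_eq
  proof (intro allI conjI ballI \<pi>m)
    fix n h assume h: "h \<in> space (hist_space n)"
    then have B: "Av (snd h) \<in> sets act" by (intro Av_sets) (auto simp: hist_space_def space_pair_measure)
    have "emeasure (\<sigma> k n h) (Av (snd h)) = 1" for k
      using \<sigma>[of k] h prob_space.finite_measure[of "\<sigma> k n h"] \<sigma>p[OF h, of k]
      by (auto simp: policies_def space_prob_algebra finite_measure.emeasure_eq_measure)
    then have "emeasure (\<pi> n h) (Av (snd h)) = 1"
      using postp[OF h] unfolding e\<pi>[OF h B] by (simp add: space_prob_algebra prob_space.emeasure_space_1)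
    then show "measure (\<pi> n h) (Av (snd h)) = 1" by (simp add: measure_def)
  qed
  have "is_strategic_measure (measure_pmf p \<bind> (\<lambda>_. l)) \<pi> (measure_pmf p \<bind> P)"
  proof (rule is_strategic_measure_mixture[OF \<sigma> \<pi> l P])
    fix n B C assume B[measurable]: "B \<in> sets act" and C[measurable]: "C \<in> sets (hist_space n)"
    note [measurable] = measurable_policy[OF \<sigma> B] measurable_policy[OF \<pi> B]
    have "(\<integral>\<^sup>+k. \<integral>\<^sup>+\<omega>. emeasure (\<sigma> k n (hist n \<omega>)) B * indicator C (hist n \<omega>) \<partial>P k \<partial>p)
      = (\<integral>\<^sup>+k. \<integral>\<^sup>+h. emeasure (\<sigma> k n h) B * indicator C h \<partial>M n k \<partial>p)"
      by (simp add: M_def nn_integral_distr)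
    also have "\<dots> = (\<integral>\<^sup>+h. \<integral>\<^sup>+k. emeasure (\<sigma> k n h) B * indicator C h \<partial>post n h \<partial>(measure_pmf p \<bind> M n))"
      by (rule bayes) measurable
    also have "\<dots> = (\<integral>\<^sup>+h. emeasure (\<pi> n h) B * indicator C h \<partial>(measure_pmf p \<bind> M n))"
    proof (rule nn_integral_cong)
      fix h assume "h \<in> space (measure_pmf p \<bind> M n)"
      moreover have "sets (measure_pmf p \<bind> M n) = sets (hist_space n)"
        using bind_pmf_in_prob_algebra[of "M n" "hist_space n" p, OF Mp] by (simp add: space_prob_algebra)
      ultimately have h: "h \<in> space (hist_space n)" using sets_eq_imp_space_eq by metis
      have "sets (post n h) = UNIV" using postp[OF h] by (simp add: space_prob_algebra)
      then have "(\<lambda>k. emeasure (\<sigma> k n h) B) \<in> borel_measurable (post n h)" by (simp add: measurable_def)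
      then show "(\<integral>\<^sup>+k. emeasure (\<sigma> k n h) B * indicator C h \<partial>post n h) = emeasure (\<pi> n h) B * indicator C h"
        by (simp add: e\<pi>[OF h B] nn_integral_multc)
    qed
    also have "\<dots> = (\<integral>\<^sup>+\<omega>. emeasure (\<pi> n (hist n \<omega>)) B * indicator C (hist n \<omega>) \<partial>(measure_pmf p \<bind> P))"
      unfolding R_def[symmetric] by (rule MR) measurable
    finally show "(\<integral>\<^sup>+k. \<integral>\<^sup>+\<omega>. emeasure (\<sigma> k n (hist n \<omega>)) B * indicator C (hist n \<omega>) \<partial>P k \<partial>p)
      = (\<integral>\<^sup>+\<omega>. emeasure (\<pi> n (hist n \<omega>)) B * indicator C (hist n \<omega>) \<partial>(measure_pmf p \<bind> P))" .
  qed
  moreover have "measure_pmf p \<bind> (\<lambda>_. l) = l"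
    using l by (intro bind_const' measure_pmf.prob_space_axioms) (simp add: space_prob_algebra prob_space_imp_subprob_space)
  ultimately have "strategic_measure l \<pi> = measure_pmf p \<bind> P"
    by (intro strategic_measure_eqI[OF \<pi>]) simp
  with \<pi> show thesis by (intro that[of \<pi>]) (simp_all add: P_def[abs_def])
qed

section \<open>Delaying a policy and shifting trajectories\<close>

text \<open>
  The history of length \<open>n\<close> that remains of a history of length \<open>n + k\<close> when its first \<open>k\<close> steps are
  forgotten. It is extensional outside \<open>{0..<n}\<close>, as elements of the history space must be.
\<close>

definition shift_hist :: "nat \<Rightarrow> nat \<Rightarrow> (nat \<Rightarrow> 'x \<times> 'a) \<times> 'x \<Rightarrow> (nat \<Rightarrow> 'x \<times> 'a) \<times> 'x" where
  "shift_hist k n h = (\<lambda>i\<in>{0..<n}. fst h (i + k), snd h)"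

definition shift_traj :: "nat \<Rightarrow> (nat \<Rightarrow> 'x \<times> 'a) \<Rightarrow> (nat \<Rightarrow> 'x \<times> 'a)" where
  "shift_traj k \<omega> = (\<lambda>i. \<omega> (i + k))"

definition delay_policy where
  "delay_policy \<sigma> k \<pi> n h = (if n < k then \<sigma> (snd h) else \<pi> (n - k) (shift_hist k (n - k) h))"

lemma shift_traj_apply: "shift_traj k \<omega> i = \<omega> (i + k)"
  by (simp add: shift_traj_def)

lemma measurable_shift_traj[measurable]: "shift_traj k \<in> traj_space \<rightarrow>\<^sub>M traj_space"
  unfolding shift_traj_def[abs_def] traj_space_def by (rule measurable_PiM_single') (auto simp: space_PiM)

lemma measurable_shift_hist[measurable]: "shift_hist k n \<in> hist_space (n + k) \<rightarrow>\<^sub>M hist_space n"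
  unfolding shift_hist_def[abs_def] hist_space_def
proof (rule measurable_Pair)
  show "(\<lambda>h. \<lambda>i\<in>{0..<n}. fst h (i + k)) \<in> Pi\<^sub>M {0..<n + k} (\<lambda>_. X \<Otimes>\<^sub>M act) \<Otimes>\<^sub>M X \<rightarrow>\<^sub>M Pi\<^sub>M {0..<n} (\<lambda>_. X \<Otimes>\<^sub>M act)"
    by (rule measurable_restrict, rule measurable_compose[OF measurable_fst], rule measurable_component_singleton) auto
qed measurable

lemma measurable_hist_state[measurable]: "snd \<in> hist_space n \<rightarrow>\<^sub>M X"
  by (simp add: hist_space_def)

lemma hist_shift_traj: "hist n (shift_traj k \<omega>) = shift_hist k n (hist (n + k) \<omega>)"
  by (auto simp: hist_def shift_traj_def shift_hist_def fun_eq_iff)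

lemma hist_act_shift_traj: "hist_act n (shift_traj k \<omega>) = (shift_hist k n (fst (hist_act (n + k) \<omega>)), snd (hist_act (n + k) \<omega>))"
  by (simp add: hist_act_def hist_shift_traj shift_traj_apply)

lemma delay_policy_in_policies:
  assumes \<sigma>: "\<sigma> \<in> markov_kernels" and \<pi>: "\<pi> \<in> policies"
  shows "delay_policy \<sigma> k \<pi> \<in> policies"
  unfolding policies_def mem_Collect_eq
proof (intro allI conjI ballI)
  fix n
  have \<sigma>m: "\<sigma> \<in> X \<rightarrow>\<^sub>M prob_algebra act" using \<sigma> by (simp add: markov_kernels_def)
  have sh: "shift_hist k (n - k) \<in> hist_space n \<rightarrow>\<^sub>M hist_space (n - k)" if "\<not> n < k"
    using measurable_shift_hist[of k "n - k"] that by simp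
  show "delay_policy \<sigma> k \<pi> n \<in> hist_space n \<rightarrow>\<^sub>M prob_algebra act"
    using measurable_compose[OF measurable_hist_state \<sigma>m] measurable_compose[OF sh policiesD[OF \<pi>]]
    by (cases "n < k") (simp_all add: delay_policy_def[abs_def])
  fix h assume h: "h \<in> space (hist_space n)"
  show "measure (delay_policy \<sigma> k \<pi> n h) (Av (snd h)) = 1"
  proof (cases "n < k")
    case True
    then show ?thesis using \<sigma> measurable_space[OF measurable_hist_state h]
      by (simp add: delay_policy_def markov_kernels_def)
  next
    case False
    have "snd (shift_hist k (n - k) h) = snd h" by (simp add: shift_hist_def)
    with False show ?thesis using \<pi> measurable_space[OF sh[OF False] h]
      by (force simp: delay_policy_def policies_def)
  qed
qed

text \<open>
  The kernel \<open>\<sigma>\<close> determines the joint law \<open>J\<close> of the state and the action at time \<open>n\<close>: both sides of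
  the identity \<open>J = \<nu> \<bind> \<kappa>\<close> agree on rectangles, by the action law of the strategic measure. Integrating
  \<open>Q\<close> against \<open>J\<close> then gives the next state law.
\<close>

lemma state_law_step:
  assumes \<sigma>: "\<sigma> \<in> markov_kernels" and \<pi>: "\<pi> \<in> policies" and P: "is_strategic_measure l \<pi> P"
    and now: "\<And>h. \<pi> n h = \<sigma> (snd h)"
  shows "distr P X (\<lambda>\<omega>. fst (\<omega> (Suc n))) = distr P X (\<lambda>\<omega>. fst (\<omega> n)) \<bind> Q_under \<sigma>"
proof -
  note S = P[unfolded is_strategic_measure_iff[OF \<pi>]]
  have Pp: "P \<in> space (prob_algebra traj_space)" using S by blast
  then have sP[measurable_cong]: "sets P = sets traj_space" and pP: "prob_space P" by (auto simp: space_prob_algebra)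
  have spP: "space P = space traj_space" by (rule sets_eq_imp_space_eq[OF sP])
  interpret P: prob_space P by fact
  have \<sigma>m[measurable]: "\<sigma> \<in> X \<rightarrow>\<^sub>M prob_algebra act" using \<sigma> by (simp add: markov_kernels_def)
  have \<sigma>B: "(\<lambda>x. emeasure (\<sigma> x) B) \<in> borel_measurable X" if "B \<in> sets act" for B
    using measurable_emeasure_kernel[OF measurable_prob_algebraD[OF \<sigma>m] that] .
  define \<nu> where "\<nu> = distr P X (\<lambda>\<omega>. fst (\<omega> n))"
  have \<nu>p: "\<nu> \<in> space (prob_algebra X)"
    unfolding \<nu>_def by (simp add: space_prob_algebra P.prob_space_distr)
  then have s\<nu>[measurable_cong]: "sets \<nu> = sets X" by (simp add: space_prob_algebra)
  have sp\<nu>: "space \<nu> = space X" by (rule sets_eq_imp_space_eq[OF s\<nu>])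
  define \<kappa> where "\<kappa> x = distr (\<sigma> x) (X \<Otimes>\<^sub>M act) (Pair x)" for x
  have \<kappa>m: "\<kappa> \<in> X \<rightarrow>\<^sub>M prob_algebra (X \<Otimes>\<^sub>M act)"
    unfolding \<kappa>_def by measurable
  have \<sigma>sp: "sets (\<sigma> x) = sets act" "space (\<sigma> x) = space act" if "x \<in> space X" for x
    using measurable_space[OF \<sigma>m that] by (auto simp: space_prob_algebra dest: sets_eq_imp_space_eq)
  define J where "J = distr P (X \<Otimes>\<^sub>M act) (\<lambda>\<omega>. \<omega> n)"
  have sJ: "sets J = sets (X \<Otimes>\<^sub>M act)" "prob_space J" by (simp_all add: J_def P.prob_space_distr)
  have sK: "sets (\<nu> \<bind> \<kappa>) = sets (X \<Otimes>\<^sub>M act)" "prob_space (\<nu> \<bind> \<kappa>)"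
    using sets_bind'[OF \<nu>p \<kappa>m] prob_space_bind'[OF \<nu>p \<kappa>m] by auto
  have spJ: "space J = space X \<times> space act" "space (\<nu> \<bind> \<kappa>) = space X \<times> space act"
    using sets_eq_imp_space_eq[OF sJ(1)] sets_eq_imp_space_eq[OF sK(1)] by (auto simp: space_pair_measure)
  have "distr J (X \<Otimes>\<^sub>M act) (\<lambda>y. (fst y, snd y)) = distr (\<nu> \<bind> \<kappa>) (X \<Otimes>\<^sub>M act) (\<lambda>y. (fst y, snd y))"
  proof (rule joint_eqI[OF sJ(2) sK(2)])
    fix C B assume C[measurable]: "C \<in> sets X" and B[measurable]: "B \<in> sets act"
    note [measurable] = \<sigma>B[OF B]
    have CB: "{y \<in> space X \<times> space act. fst y \<in> C \<and> snd y \<in> B} = C \<times> B"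
      using sets.sets_into_space[OF C] sets.sets_into_space[OF B] by auto
    have "emeasure J (C \<times> B) = emeasure P {\<omega>\<in>space P. hist n \<omega> \<in> snd -` C \<inter> space (hist_space n) \<and> snd (\<omega> n) \<in> B}"
      unfolding J_def using measurable_space[OF measurable_hist, of _ n]
      by (subst emeasure_distr) (auto simp: spP hist_def mem_Times_iff intro!: arg_cong[where f="emeasure P"])
    also have "\<dots> = (\<integral>\<^sup>+\<omega>. emeasure (\<pi> n (hist n \<omega>)) B * indicator (snd -` C \<inter> space (hist_space n)) (hist n \<omega>) \<partial>P)"
      using S measurable_sets[OF measurable_hist_state C] B by blast
    also have "\<dots> = (\<integral>\<^sup>+\<omega>. emeasure (\<sigma> (fst (\<omega> n))) B * indicator C (fst (\<omega> n)) \<partial>P)"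
      using measurable_space[OF measurable_hist, of _ n]
      by (intro nn_integral_cong) (auto simp: spP now hist_def split: split_indicator)
    also have "\<dots> = (\<integral>\<^sup>+x. emeasure (\<sigma> x) B * indicator C x \<partial>\<nu>)"
      unfolding \<nu>_def by (subst nn_integral_distr) auto
    also have "\<dots> = (\<integral>\<^sup>+x. emeasure (\<kappa> x) (C \<times> B) \<partial>\<nu>)"
    proof (rule nn_integral_cong)
      fix x assume "x \<in> space \<nu>"
      then have x: "x \<in> space X" by (simp add: sp\<nu>)
      have "Pair x \<in> \<sigma> x \<rightarrow>\<^sub>M X \<Otimes>\<^sub>M act" using x \<sigma>sp[OF x] by (simp cong: measurable_cong_sets)
      then have "emeasure (\<kappa> x) (C \<times> B) = emeasure (\<sigma> x) (Pair x -` (C \<times> B) \<inter> space act)"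
        unfolding \<kappa>_def by (subst emeasure_distr) (auto simp: \<sigma>sp[OF x])
      also have "Pair x -` (C \<times> B) \<inter> space act = (if x \<in> C then B else {})"
        using sets.sets_into_space[OF B] by auto
      finally show "emeasure (\<sigma> x) B * indicator C x = emeasure (\<kappa> x) (C \<times> B)" by simp
    qed
    also have "\<dots> = emeasure (\<nu> \<bind> \<kappa>) (C \<times> B)"
      by (rule emeasure_bind_prob_algebra[OF \<nu>p \<kappa>m, symmetric]) measurable
    finally show "emeasure J {y \<in> space J. fst y \<in> C \<and> snd y \<in> B} =
        emeasure (\<nu> \<bind> \<kappa>) {y \<in> space (\<nu> \<bind> \<kappa>). fst y \<in> C \<and> snd y \<in> B}"
      unfolding spJ CB .
  qed (simp_all add: sJ sK cong: measurable_cong_sets)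
  then have joint: "J = \<nu> \<bind> \<kappa>"
    by (simp add: distr_id2 sJ(1) sK(1))
  show ?thesis
    unfolding \<nu>_def[symmetric]
  proof (rule measure_eqI)
    note Qm = Q_under_kernel[OF \<sigma>]
    show "sets (distr P X (\<lambda>\<omega>. fst (\<omega> (Suc n)))) = sets (\<nu> \<bind> Q_under \<sigma>)"
      using sets_bind'[OF \<nu>p Qm] by simp
    fix D assume "D \<in> sets (distr P X (\<lambda>\<omega>. fst (\<omega> (Suc n))))"
    then have D[measurable]: "D \<in> sets X" by simp
    note [measurable] = measurable_Q[OF D]
    have "emeasure (distr P X (\<lambda>\<omega>. fst (\<omega> (Suc n)))) D =
      emeasure P {\<omega>\<in>space P. hist_act n \<omega> \<in> space (hist_space n \<Otimes>\<^sub>M act) \<and> fst (\<omega> (Suc n)) \<in> D}"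
      using measurable_space[OF measurable_hist_act, of _ n]
      by (subst emeasure_distr) (auto simp: spP intro!: arg_cong[where f="emeasure P"])
    also have "\<dots> = (\<integral>\<^sup>+\<omega>. emeasure (Q (\<omega> n)) D * indicator (space (hist_space n \<Otimes>\<^sub>M act)) (hist_act n \<omega>) \<partial>P)"
      using S D by blast
    also have "\<dots> = (\<integral>\<^sup>+\<omega>. emeasure (Q (\<omega> n)) D \<partial>P)"
      using measurable_space[OF measurable_hist_act, of _ n] by (intro nn_integral_cong) (auto simp: spP)
    also have "\<dots> = (\<integral>\<^sup>+y. emeasure (Q y) D \<partial>J)"
      unfolding J_def by (subst nn_integral_distr) auto
    also have "\<dots> = (\<integral>\<^sup>+x. \<integral>\<^sup>+y. emeasure (Q y) D \<partial>\<kappa> x \<partial>\<nu>)"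
      unfolding joint
      by (rule nn_integral_bind[OF measurable_Q[OF D]]) (use \<kappa>m in \<open>simp add: measurable_prob_algebraD cong: measurable_cong_sets\<close>)
    also have "\<dots> = (\<integral>\<^sup>+x. emeasure (Q_under \<sigma> x) D \<partial>\<nu>)"
    proof (rule nn_integral_cong)
      fix x assume "x \<in> space \<nu>"
      then have x: "x \<in> space X" by (simp add: sp\<nu>)
      have Px: "Pair x \<in> act \<rightarrow>\<^sub>M X \<Otimes>\<^sub>M act" using x by simp
      have "(\<integral>\<^sup>+y. emeasure (Q y) D \<partial>\<kappa> x) = (\<integral>\<^sup>+a. emeasure (Q (x, a)) D \<partial>\<sigma> x)"
        unfolding \<kappa>_def using Px by (subst nn_integral_distr) (simp_all add: \<sigma>sp[OF x] cong: measurable_cong_sets)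
      also have "\<dots> = emeasure (Q_under \<sigma> x) D"
        unfolding Q_under_def
        by (rule emeasure_bind_prob_algebra[OF measurable_space[OF \<sigma>m x] measurable_compose[OF Px Q_kernel] D, symmetric])
      finally show "(\<integral>\<^sup>+y. emeasure (Q y) D \<partial>\<kappa> x) = emeasure (Q_under \<sigma> x) D" .
    qed
    also have "\<dots> = emeasure (\<nu> \<bind> Q_under \<sigma>) D"
      by (rule emeasure_bind_prob_algebra[OF \<nu>p Qm D, symmetric])
    finally show "emeasure (distr P X (\<lambda>\<omega>. fst (\<omega> (Suc n)))) D = emeasure (\<nu> \<bind> Q_under \<sigma>) D" .
  qed
qed

lemma state_law_delay_policy:
  assumes l: "l \<in> space (prob_algebra X)" and \<sigma>: "\<sigma> \<in> markov_kernels" and \<pi>: "\<pi> \<in> policies"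
    and P: "is_strategic_measure l (delay_policy \<sigma> k \<pi>) P" and "j \<le> k"
  shows "distr P X (\<lambda>\<omega>. fst (\<omega> j)) = l \<bind> Q_under_pow \<sigma> j"
  using \<open>j \<le> k\<close>
proof (induction j)
  case 0
  have "l \<bind> Q_under_pow \<sigma> 0 = l"
    using l bind_return''[of l X] by (simp add: space_prob_algebra Q_under_pow.simps(1)[abs_def])
  moreover have "distr P X (\<lambda>\<omega>. fst (\<omega> 0)) = l" using P by (simp add: is_strategic_measure_def)
  ultimately show ?case by (simp only:)
next
  case (Suc j)
  have "distr P X (\<lambda>\<omega>. fst (\<omega> (Suc j))) = distr P X (\<lambda>\<omega>. fst (\<omega> j)) \<bind> Q_under \<sigma>"
    by (rule state_law_step[OF \<sigma> delay_policy_in_policies[OF \<sigma> \<pi>] P]) (use Suc.prems in \<open>simp add: delay_policy_def\<close>)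
  also have "\<dots> = (l \<bind> Q_under_pow \<sigma> j) \<bind> Q_under \<sigma>" using Suc by simp
  also have "\<dots> = l \<bind> Q_under_pow \<sigma> (Suc j)"
  proof -
    have "Q_under_pow \<sigma> j \<in> l \<rightarrow>\<^sub>M subprob_algebra X"
      using l measurable_prob_algebraD[OF Q_under_pow_kernel[OF \<sigma>]] by (simp add: space_prob_algebra cong: measurable_cong_sets)
    from bind_assoc[OF this measurable_prob_algebraD[OF Q_under_kernel[OF \<sigma>]]]
    show ?thesis by (simp add: Q_under_pow.simps(2)[abs_def])
  qed
  finally show ?case .
qed

text \<open>
  The conditions characterising a strategic measure at time \<open>n\<close> for the shifted trajectory are those
  at time \<open>n + k\<close> for the original one, restricted to events that depend only on what happens from
  time \<open>k\<close> on. From that time on the delayed policy acts as \<open>\<pi>\<close> does on the remaining history.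
\<close>

lemma strategic_measure_shift:
  assumes l: "l \<in> space (prob_algebra X)" and \<sigma>: "\<sigma> \<in> markov_kernels" and \<pi>: "\<pi> \<in> policies"
  shows "strategic_measure (l \<bind> Q_under_pow \<sigma> k) \<pi> =
    distr (strategic_measure l (delay_policy \<sigma> k \<pi>)) traj_space (shift_traj k)"
proof (rule strategic_measure_eqI[OF \<pi>])
  define P where "P = strategic_measure l (delay_policy \<sigma> k \<pi>)"
  have d: "delay_policy \<sigma> k \<pi> \<in> policies" by (rule delay_policy_in_policies[OF \<sigma> \<pi>])
  have P: "is_strategic_measure l (delay_policy \<sigma> k \<pi>) P"
    unfolding P_def by (rule is_strategic_measure_strategic_measure[OF l d])
  note S = P[unfolded is_strategic_measure_iff[OF d]]
  have Pp: "P \<in> space (prob_algebra traj_space)" using S by blast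
  then have sP[measurable_cong]: "sets P = sets traj_space" and pP: "prob_space P" by (auto simp: space_prob_algebra)
  have spP: "space P = space traj_space" by (rule sets_eq_imp_space_eq[OF sP])
  interpret P: prob_space P by fact
  let ?R = "distr P traj_space (shift_traj k)"
  note sh = measurable_space[OF measurable_shift_traj]
  show "is_strategic_measure (l \<bind> Q_under_pow \<sigma> k) \<pi> (distr (strategic_measure l (delay_policy \<sigma> k \<pi>)) traj_space (shift_traj k))"
    unfolding P_def[symmetric] is_strategic_measure_iff[OF \<pi>]
  proof (intro conjI allI ballI)
    show "?R \<in> space (prob_algebra traj_space)"
      by (simp add: space_prob_algebra P.prob_space_distr)
    have "distr ?R X (\<lambda>\<omega>. fst (\<omega> 0)) = distr P X (\<lambda>\<omega>. fst (\<omega> k))"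
      by (subst distr_distr) (auto simp: o_def shift_traj_def)
    then show "distr ?R X (\<lambda>\<omega>. fst (\<omega> 0)) = l \<bind> Q_under_pow \<sigma> k"
      using state_law_delay_policy[OF l \<sigma> \<pi> P order_refl] by simp
  next
    fix n B C assume B[measurable]: "B \<in> sets act" and C[measurable]: "C \<in> sets (hist_space n)"
    note [measurable] = measurable_compose[OF measurable_hist measurable_policy[OF \<pi> B]]
    let ?C = "shift_hist k n -` C \<inter> space (hist_space (n + k))"
    have "emeasure ?R {\<omega>\<in>space ?R. hist n \<omega> \<in> C \<and> snd (\<omega> n) \<in> B}
      = emeasure P {\<omega>\<in>space P. hist (n + k) \<omega> \<in> ?C \<and> snd (\<omega> (n + k)) \<in> B}"
      using measurable_space[OF measurable_hist, of _ "n + k"] sh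
      by (subst emeasure_distr) (auto simp: spP hist_shift_traj shift_traj_apply intro!: arg_cong[where f="emeasure P"])
    also have "\<dots> = (\<integral>\<^sup>+\<omega>. emeasure (delay_policy \<sigma> k \<pi> (n + k) (hist (n + k) \<omega>)) B * indicator ?C (hist (n + k) \<omega>) \<partial>P)"
      using S measurable_sets[OF measurable_shift_hist C] B by blast
    also have "\<dots> = (\<integral>\<^sup>+\<omega>. emeasure (\<pi> n (hist n (shift_traj k \<omega>))) B * indicator C (hist n (shift_traj k \<omega>)) \<partial>P)"
      using measurable_space[OF measurable_hist, of _ "n + k"]
      by (intro nn_integral_cong) (auto simp: spP delay_policy_def hist_shift_traj split: split_indicator)
    also have "\<dots> = (\<integral>\<^sup>+\<omega>. emeasure (\<pi> n (hist n \<omega>)) B * indicator C (hist n \<omega>) \<partial>?R)"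
      by (subst nn_integral_distr) auto
    finally show "emeasure ?R {\<omega>\<in>space ?R. hist n \<omega> \<in> C \<and> snd (\<omega> n) \<in> B}
      = (\<integral>\<^sup>+\<omega>. emeasure (\<pi> n (hist n \<omega>)) B * indicator C (hist n \<omega>) \<partial>?R)" .
  next
    fix n D C assume D[measurable]: "D \<in> sets X" and C[measurable]: "C \<in> sets (hist_space n \<Otimes>\<^sub>M act)"
    note [measurable] = measurable_compose[OF measurable_traj measurable_Q[OF D]]
    let ?sh = "\<lambda>y. (shift_hist k n (fst y), snd y)"
    let ?C = "?sh -` C \<inter> space (hist_space (n + k) \<Otimes>\<^sub>M act)"
    have shm: "?sh \<in> hist_space (n + k) \<Otimes>\<^sub>M act \<rightarrow>\<^sub>M hist_space n \<Otimes>\<^sub>M act" by measurable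
    have "emeasure ?R {\<omega>\<in>space ?R. hist_act n \<omega> \<in> C \<and> fst (\<omega> (Suc n)) \<in> D}
      = emeasure P {\<omega>\<in>space P. hist_act (n + k) \<omega> \<in> ?C \<and> fst (\<omega> (Suc (n + k))) \<in> D}"
      using measurable_space[OF measurable_hist_act, of _ "n + k"] sh
      by (subst emeasure_distr) (auto simp: spP hist_act_shift_traj shift_traj_apply intro!: arg_cong[where f="emeasure P"])
    also have "\<dots> = (\<integral>\<^sup>+\<omega>. emeasure (Q (\<omega> (n + k))) D * indicator ?C (hist_act (n + k) \<omega>) \<partial>P)"
      using S measurable_sets[OF shm C] D by blast
    also have "\<dots> = (\<integral>\<^sup>+\<omega>. emeasure (Q (shift_traj k \<omega> n)) D * indicator C (hist_act n (shift_traj k \<omega>)) \<partial>P)"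
      using measurable_space[OF measurable_hist_act, of _ "n + k"]
      by (intro nn_integral_cong) (auto simp: spP shift_traj_apply hist_act_shift_traj split: split_indicator)
    also have "\<dots> = (\<integral>\<^sup>+\<omega>. emeasure (Q (\<omega> n)) D * indicator C (hist_act n \<omega>) \<partial>?R)"
      by (subst nn_integral_distr) auto
    finally show "emeasure ?R {\<omega>\<in>space ?R. hist_act n \<omega> \<in> C \<and> fst (\<omega> (Suc n)) \<in> D}
      = (\<integral>\<^sup>+\<omega>. emeasure (Q (\<omega> n)) D * indicator C (hist_act n \<omega>) \<partial>?R)" .
  qed
qed

section \<open>Hitting times and discounted initial distributions\<close>

lemma less_hitting_time_iff: "enat n < hitting_time \<Delta> \<omega> \<longleftrightarrow> (\<forall>i\<le>n. fst (\<omega> i) \<notin> \<Delta>)"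
proof (cases "\<exists>i. fst (\<omega> i) \<in> \<Delta>")
  case True
  then have L: "fst (\<omega> (LEAST i. fst (\<omega> i) \<in> \<Delta>)) \<in> \<Delta>" (is "fst (\<omega> ?L) \<in> _") by (rule LeastI_ex)
  have "n < ?L \<longleftrightarrow> (\<forall>i\<le>n. fst (\<omega> i) \<notin> \<Delta>)"
  proof
    show "\<forall>i\<le>n. fst (\<omega> i) \<notin> \<Delta>" if "n < ?L" using that not_less_Least by (meson le_less_trans)
    show "n < ?L" if "\<forall>i\<le>n. fst (\<omega> i) \<notin> \<Delta>" using that L by (meson not_le)
  qed
  with True show ?thesis by (simp add: hitting_time_def)
qed (simp add: hitting_time_def)

lemma measurable_hitting_time:
  assumes [measurable]: "\<Delta> \<in> sets X"
  shows "hitting_time \<Delta> \<in> traj_space \<rightarrow>\<^sub>M count_space UNIV"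
proof -
  have [measurable]: "Measurable.pred traj_space (\<lambda>\<omega>. fst (\<omega> n) \<in> \<Delta>)" for n by measurable
  show ?thesis unfolding hitting_time_def[abs_def] by measurable
qed

text \<open>
  Apply the transition law to the event that the state is in the target at time \<open>n\<close> and outside it
  at time \<open>n + 1\<close>: from a state of the target this transition has probability zero.
\<close>

lemma AE_target_absorbing:
  assumes \<Delta>[measurable]: "\<Delta> \<in> sets X" and abs: "\<And>x a. x \<in> \<Delta> \<Longrightarrow> a \<in> A \<Longrightarrow> measure (Q (x, a)) \<Delta> = 1"
    and \<pi>: "\<pi> \<in> policies" and P: "is_strategic_measure l \<pi> P"
  shows "AE \<omega> in P. fst (\<omega> n) \<in> \<Delta> \<longrightarrow> fst (\<omega> (Suc n)) \<in> \<Delta>"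
proof -
  note S = P[unfolded is_strategic_measure_iff[OF \<pi>]]
  have Pp: "P \<in> space (prob_algebra traj_space)" using S by blast
  then have sP[measurable_cong]: "sets P = sets traj_space" by (auto simp: space_prob_algebra)
  have spP: "space P = space traj_space" by (rule sets_eq_imp_space_eq[OF sP])
  let ?C = "{y \<in> space (hist_space n \<Otimes>\<^sub>M act). snd (fst y) \<in> \<Delta>}"
  let ?D = "space X - \<Delta>"
  have Q0: "emeasure (Q (x, a)) ?D = 0" if "x \<in> \<Delta>" "a \<in> A" for x a
  proof -
    have "x \<in> space X" using that sets.sets_into_space[OF \<Delta>] by auto
    then have "Q (x, a) \<in> space (prob_algebra X)"
      using that by (intro measurable_space[OF Q_kernel]) (simp add: space_pair_measure space_restrict_space)
    then have q: "prob_space (Q (x, a))" "sets (Q (x, a)) = sets X" "space (Q (x, a)) = space X"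
      by (auto simp: space_prob_algebra dest: sets_eq_imp_space_eq)
    interpret q: prob_space "Q (x, a)" by fact
    show ?thesis using q.prob_compl[of \<Delta>] abs[OF that] by (simp add: q q.emeasure_eq_measure)
  qed
  have st: "fst (\<omega> i) \<in> space X" "snd (\<omega> i) \<in> A" if "\<omega> \<in> space traj_space" for \<omega> i
    using measurable_space[OF measurable_traj that, of i] by (auto simp: space_pair_measure space_restrict_space)
  have "{\<omega>\<in>space P. \<not> (fst (\<omega> n) \<in> \<Delta> \<longrightarrow> fst (\<omega> (Suc n)) \<in> \<Delta>)}
    = {\<omega>\<in>space P. hist_act n \<omega> \<in> ?C \<and> fst (\<omega> (Suc n)) \<in> ?D}"
    using st measurable_space[OF measurable_hist_act, of _ n] by (auto simp: spP hist_act_def hist_def)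
  moreover have "emeasure P {\<omega>\<in>space P. hist_act n \<omega> \<in> ?C \<and> fst (\<omega> (Suc n)) \<in> ?D}
    = (\<integral>\<^sup>+\<omega>. emeasure (Q (\<omega> n)) ?D * indicator ?C (hist_act n \<omega>) \<partial>P)"
  proof -
    have "?C \<in> sets (hist_space n \<Otimes>\<^sub>M act)" by measurable
    moreover have "?D \<in> sets X" by measurable
    ultimately show ?thesis using S by blast
  qed
  moreover have "\<dots> = (\<integral>\<^sup>+\<omega>. 0 \<partial>P)"
  proof (rule nn_integral_cong)
    fix \<omega> assume "\<omega> \<in> space P"
    then show "emeasure (Q (\<omega> n)) ?D * indicator ?C (hist_act n \<omega>) = 0"
      using Q0[of "fst (\<omega> n)" "snd (\<omega> n)"] st[of \<omega> n] by (auto simp: spP hist_act_def hist_def split: split_indicator)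
  qed
  ultimately have "emeasure P {\<omega>\<in>space P. \<not> (fst (\<omega> n) \<in> \<Delta> \<longrightarrow> fst (\<omega> (Suc n)) \<in> \<Delta>)} = 0" by simp
  moreover have "{\<omega>\<in>space P. \<not> (fst (\<omega> n) \<in> \<Delta> \<longrightarrow> fst (\<omega> (Suc n)) \<in> \<Delta>)} \<in> sets P" by measurable
  ultimately show ?thesis by (rule AE_I[OF subset_refl])
qed

text \<open>
  A trajectory that hits the target at a time \<open>m\<close> is still in the target at time \<open>m + k\<close>, which is
  time \<open>m\<close> of the shifted trajectory; so the shifted one has hit the target by time \<open>m\<close>.
\<close>

lemma hitting_time_shift_le:
  assumes "\<forall>n. fst (\<omega> n) \<in> \<Delta> \<longrightarrow> fst (\<omega> (Suc n)) \<in> \<Delta>"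
  shows "hitting_time \<Delta> (shift_traj k \<omega>) \<le> hitting_time \<Delta> \<omega>"
proof (rule ccontr)
  assume "\<not> ?thesis"
  then have lt: "hitting_time \<Delta> \<omega> < hitting_time \<Delta> (shift_traj k \<omega>)" by simp
  then obtain n where n: "hitting_time \<Delta> \<omega> = enat n" by (cases "hitting_time \<Delta> \<omega>") auto
  with lt have "\<forall>i\<le>n. fst (\<omega> (i + k)) \<notin> \<Delta>" by (simp add: less_hitting_time_iff shift_traj_apply)
  then have "fst (\<omega> (n + k)) \<notin> \<Delta>" by simp
  moreover obtain m where m: "m \<le> n" "fst (\<omega> m) \<in> \<Delta>"
    using less_hitting_time_iff[of n \<Delta> \<omega>] n by auto
  moreover have "fst (\<omega> (m + j)) \<in> \<Delta>" for j using m(2) assms by (induction j) auto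
  from this[of "n + k - m"] m(1) have "fst (\<omega> (n + k)) \<in> \<Delta>" by simp
  ultimately show False by simp
qed

lemma hitting_time_delay_policy_ge:
  assumes l: "l \<in> space (prob_algebra X)" and \<sigma>: "\<sigma> \<in> markov_kernels" and \<pi>: "\<pi> \<in> policies"
    and \<Delta>: "\<Delta> \<in> sets X" and abs: "\<And>x a. x \<in> \<Delta> \<Longrightarrow> a \<in> A \<Longrightarrow> measure (Q (x, a)) \<Delta> = 1"
  shows "(\<integral>\<^sup>+\<omega>. ennreal_of_enat (hitting_time \<Delta> \<omega>) \<partial>strategic_measure (l \<bind> Q_under_pow \<sigma> k) \<pi>)
    \<le> (\<integral>\<^sup>+\<omega>. ennreal_of_enat (hitting_time \<Delta> \<omega>) \<partial>strategic_measure l (delay_policy \<sigma> k \<pi>))"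
proof -
  define P where "P = strategic_measure l (delay_policy \<sigma> k \<pi>)"
  have d: "delay_policy \<sigma> k \<pi> \<in> policies" by (rule delay_policy_in_policies[OF \<sigma> \<pi>])
  have P: "is_strategic_measure l (delay_policy \<sigma> k \<pi>) P"
    unfolding P_def by (rule is_strategic_measure_strategic_measure[OF l d])
  have sP[measurable_cong]: "sets P = sets traj_space"
    using strategic_measure_in_space[OF l d] by (simp add: P_def space_prob_algebra)
  have [measurable]: "(\<lambda>\<omega>. ennreal_of_enat (hitting_time \<Delta> \<omega>)) \<in> borel_measurable traj_space"
    by (rule measurable_compose[OF measurable_hitting_time[OF \<Delta>]]) simp
  have "AE \<omega> in P. \<forall>n. fst (\<omega> n) \<in> \<Delta> \<longrightarrow> fst (\<omega> (Suc n)) \<in> \<Delta>"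
    by (rule AE_all_countable[THEN iffD2, OF allI]) (rule AE_target_absorbing[OF \<Delta> abs d P])
  then have "(\<integral>\<^sup>+\<omega>. ennreal_of_enat (hitting_time \<Delta> (shift_traj k \<omega>)) \<partial>P)
      \<le> (\<integral>\<^sup>+\<omega>. ennreal_of_enat (hitting_time \<Delta> \<omega>) \<partial>P)"
    by (intro nn_integral_mono_AE) (auto elim!: eventually_mono intro!: hitting_time_shift_le simp: ennreal_of_enat_le_iff)
  then show ?thesis
    unfolding strategic_measure_shift[OF l \<sigma> \<pi>] P_def[symmetric]
    by (subst nn_integral_distr) measurable
qed

lemma bind_Q_under_pow_in_prob_algebra:
  assumes l: "l \<in> space (prob_algebra X)" and \<sigma>: "\<sigma> \<in> markov_kernels"
  shows "l \<bind> Q_under_pow \<sigma> k \<in> space (prob_algebra X)"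
  using sets_bind'[OF l Q_under_pow_kernel[OF \<sigma>]] prob_space_bind'[OF l Q_under_pow_kernel[OF \<sigma>]]
  by (simp add: space_prob_algebra)

lemma discounted_initial_eq_bind_geometric:
  assumes l: "l \<in> space (prob_algebra X)" and \<sigma>: "\<sigma> \<in> markov_kernels" and b: "0 < \<beta>" "\<beta> < 1"
  shows "discounted_initial l \<sigma> \<beta> = measure_pmf (geometric_pmf (1 - \<beta>)) \<bind> (\<lambda>k. l \<bind> Q_under_pow \<sigma> k)"
proof (rule measure_eqI)
  have lk: "l \<bind> Q_under_pow \<sigma> k \<in> space (prob_algebra X)" for k
    by (rule bind_Q_under_pow_in_prob_algebra[OF l \<sigma>])
  show "sets (discounted_initial l \<sigma> \<beta>) = sets (measure_pmf (geometric_pmf (1 - \<beta>)) \<bind> (\<lambda>k. l \<bind> Q_under_pow \<sigma> k))"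
    using discounted_initial_prob[OF l \<sigma> b] bind_pmf_in_prob_algebra[of "\<lambda>k. l \<bind> Q_under_pow \<sigma> k" X, OF lk]
    by (simp add: space_prob_algebra)
  fix D assume "D \<in> sets (discounted_initial l \<sigma> \<beta>)"
  then have D: "D \<in> sets X" by (simp add: discounted_initial_def)
  have "ennreal (pmf (geometric_pmf (1 - \<beta>)) k) * c = ennreal (1 - \<beta>) * (ennreal (\<beta> ^ k) * c)" for k c
    using b by (simp add: ennreal_mult mult_ac)
  then show "emeasure (discounted_initial l \<sigma> \<beta>) D =
      emeasure (measure_pmf (geometric_pmf (1 - \<beta>)) \<bind> (\<lambda>k. l \<bind> Q_under_pow \<sigma> k)) D"
    by (simp add: emeasure_discounted_initial[OF l \<sigma> D] emeasure_bind_pmf[OF lk D]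
        nn_integral_measure_pmf nn_integral_count_space_nat)
qed

theorem absorbing_discounted_initial:
  assumes l: "l \<in> space (prob_algebra X)" and \<sigma>: "\<sigma> \<in> markov_kernels" and b: "0 < \<beta>" "\<beta> < 1"
    and \<Delta>: "\<Delta> \<in> sets X" and absorbing: "absorbing l \<Delta>"
  shows "absorbing (discounted_initial l \<sigma> \<beta>) \<Delta>"
proof -
  let ?T = "\<lambda>\<omega>. ennreal_of_enat (hitting_time \<Delta> \<omega>)"
  let ?p = "geometric_pmf (1 - \<beta>)"
  have abs: "measure (Q (x, a)) \<Delta> = 1" if "x \<in> \<Delta>" "a \<in> A" for x a
    using absorbing that by (simp add: absorbing_def)
  have Tm: "?T \<in> borel_measurable traj_space"
    by (rule measurable_compose[OF measurable_hitting_time[OF \<Delta>]]) simp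
  have lk: "l \<bind> Q_under_pow \<sigma> k \<in> space (prob_algebra X)" for k
    by (rule bind_Q_under_pow_in_prob_algebra[OF l \<sigma>])
  have "(\<integral>\<^sup>+\<omega>. ?T \<omega> \<partial>strategic_measure (discounted_initial l \<sigma> \<beta>) \<pi>) < \<infinity>" if \<pi>: "\<pi> \<in> policies" for \<pi>
  proof -
    have d: "delay_policy \<sigma> k \<pi> \<in> policies" for k by (rule delay_policy_in_policies[OF \<sigma> \<pi>])
    \<comment> \<open>One policy from \<open>l\<close> that realises the geometrically distributed delay.\<close>
    obtain \<pi>' where \<pi>': "\<pi>' \<in> policies"
      and mix: "strategic_measure l \<pi>' = measure_pmf ?p \<bind> (\<lambda>k. strategic_measure l (delay_policy \<sigma> k \<pi>))"
      using mixture_policy_exists[of l "\<lambda>k. delay_policy \<sigma> k \<pi>" ?p, OF l d] by blast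
    have "(\<integral>\<^sup>+\<omega>. ?T \<omega> \<partial>strategic_measure (discounted_initial l \<sigma> \<beta>) \<pi>)
      = (\<integral>\<^sup>+k. \<integral>\<^sup>+\<omega>. ?T \<omega> \<partial>strategic_measure (l \<bind> Q_under_pow \<sigma> k) \<pi> \<partial>?p)"
      unfolding discounted_initial_eq_bind_geometric[OF l \<sigma> b] strategic_measure_bind_pmf[OF \<pi> lk]
      by (rule nn_integral_bind_pmf[OF strategic_measure_in_space[OF lk \<pi>] Tm])
    also have "\<dots> \<le> (\<integral>\<^sup>+k. \<integral>\<^sup>+\<omega>. ?T \<omega> \<partial>strategic_measure l (delay_policy \<sigma> k \<pi>) \<partial>?p)"
      by (intro nn_integral_mono hitting_time_delay_policy_ge[OF l \<sigma> \<pi> \<Delta> abs])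
    also have "\<dots> = (\<integral>\<^sup>+\<omega>. ?T \<omega> \<partial>strategic_measure l \<pi>')"
      unfolding mix by (rule nn_integral_bind_pmf[OF strategic_measure_in_space[OF l d] Tm, symmetric])
    also have "\<dots> < \<infinity>" using absorbing \<pi>' by (simp add: absorbing_def)
    finally show ?thesis .
  qed
  with abs show ?thesis by (simp add: absorbing_def)
qed

end

theorem proposition4p4:
  fixes X :: "'x measure"
    and A :: "'a::polish_space set"
    and Av :: "'x \<Rightarrow> 'a set"
    and Q :: "'x \<times> 'a \<Rightarrow> 'x measure"
    and \<eta> :: "'x measure"
    and \<Delta> :: "'x set"
    and \<xi> :: "'x \<Rightarrow> 'a measure"
    and \<beta> :: real
  assumes model: "control_model X A Av Q"
    and initial: "\<eta> \<in> space (prob_algebra X)"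
    and target: "\<Delta> \<in> sets X"
    and S: "control_model.condition_S X A Av Q"
    and xi: "\<xi> \<in> control_model.markov_kernels X A Av"
    and xi_dominates: "\<And>x a. x \<in> space X \<Longrightarrow> a \<in> Av x \<Longrightarrow>
      absolutely_continuous (control_model.Q_under Q \<xi> x) (Q (x, a))"
    and beta: "0 < \<beta>" "\<beta> < 1"
    and absorbing: "control_model.absorbing X A Av Q \<eta> \<Delta>"
  shows "control_model.absorbing X A Av Q (control_model.discounted_initial X Q \<eta> \<xi> \<beta>) \<Delta>"
  by (rule control_model.absorbing_discounted_initial[OF model initial xi beta target absorbing])

end
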